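(* Let $i\in\{1,\dots,6\}$ and let $A$ be a $G_i$-associative algebra over $\mathbb{K}$. Then $A\otimes -$ is a covariant functor $$A\otimes - : (G_i\text{-}ASS)^{!}\longrightarrow G_i\text{-}ASS ,$$ where, for $B$ in $(G_i\text{-}ASS)^{!}$, the vector space $A\otimes B$ carries the product $(a_1\otimes b_1).(a_2\otimes b_2)=(a_1.a_2)\otimes(b_1.b_2)$.
   Context: $\mathbb{K}$ is a commutative field of characteristic zero; algebras are not assumed unital, and $\otimes=\otimes_{\mathbb{K}}$. $\Sigma_3$ is the symmetric group of degree 3 and $G_1=\{\mathrm{Id}\}$, $G_2=\{\mathrm{Id},\tau_{12}\}$, $G_3=\{\mathrm{Id},\tau_{23}\}$, $G_4=\{\mathrm{Id},\tau_{13}\}$, $G_5=A_3$, $G_6=\Sigma_3$ are its subgroups ($\tau_{ij}$ is the transposition of $i$ and $j$). For $\sigma\in\Sigma_3$, $\sigma(X_1,X_2,X_3)=(X_{\sigma^{-1}(1)},X_{\sigma^{-1}(2)},X_{\sigma^{-1}(3)})$ and $(-1)^{\varepsilon(\sigma)}$ is the signature. An algebra $(A,\mu)$ with associator $a_\mu(X_1,X_2,X_3)=\mu(\mu(X_1,X_2),X_3)-\mu(X_1,\mu(X_2,X_3))$ is $G_i$-associative if $\sum_{\sigma\in G_i}(-1)^{\varepsilon(\sigma)}a_\mu\circ\sigma=0$. $G_i\text{-}ASS$ is the category of $G_i$-associative algebras and algebra homomorphisms; $G_i\text{-}\mathcal{A}ss$ is the corresponding binary quadratic operad. $(G_i\text{-}ASS)^!$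 is the category of algebras over the (Koszul) dual operad $G_i\text{-}\mathcal{A}ss^{!}$, that is, of associative algebras satisfying for all $a,b,c$: no further identity if $i=1$; $abc=bac$ if $i=2$; $abc=acb$ if $i=3$; $abc=cba$ if $i=4$; $abc=bca=cab$ if $i=5$; $abc=acb=bac$ if $i=6$. The functor sends a morphism $f:B\to B'$ to $\mathrm{Id}_A\otimes f$. *)

theory Defs
  imports "HOL-Algebra.Sym_Groups" "HOL-Algebra.QuotRing" "HOL-Algebra.Module"
begin

section \<open>Algebras that need not be associative or unital\<close>

text \<open>
  An algebra is a \<open>module\<close> record. Its field \<open>one\<close> carries no meaning: no axiom below mentions it,
  and homomorphisms are not required to preserve it.
\<close>

locale char_zero_field = field K for K (structure) +
  assumes char_zero: "0 < (n::nat) \<Longrightarrow> [n] \<cdot> \<one> \<noteq> \<zero>"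

locale nonassoc_algebra = module K A for K and A (structure) +
  assumes mult_closed: "\<lbrakk>x \<in> carrier A; y \<in> carrier A\<rbrakk> \<Longrightarrow> x \<otimes> y \<in> carrier A"
    and mult_add_left: "\<lbrakk>x \<in> carrier A; y \<in> carrier A; z \<in> carrier A\<rbrakk>
      \<Longrightarrow> (x \<oplus> y) \<otimes> z = x \<otimes> z \<oplus> y \<otimes> z"
    and mult_add_right: "\<lbrakk>x \<in> carrier A; y \<in> carrier A; z \<in> carrier A\<rbrakk>
      \<Longrightarrow> x \<otimes> (y \<oplus> z) = x \<otimes> y \<oplus> x \<otimes> z"
    and mult_smult_left: "\<lbrakk>k \<in> carrier K; x \<in> carrier A; y \<in> carrier A\<rbrakk>
      \<Longrightarrow> (k \<odot> x) \<otimes> y = k \<odot> (x \<otimes> y)"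
    and mult_smult_right: "\<lbrakk>k \<in> carrier K; x \<in> carrier A; y \<in> carrier A\<rbrakk>
      \<Longrightarrow> x \<otimes> (k \<odot> y) = k \<odot> (x \<otimes> y)"

text \<open>Homomorphisms are extensional functions, so that equality of morphisms is equality in HOL.\<close>

definition alg_hom ::
    "('k, 'm) ring_scheme \<Rightarrow> ('k, 'a) module \<Rightarrow> ('k, 'b) module \<Rightarrow> ('a \<Rightarrow> 'b) set" where
  "alg_hom K A B =
    {f \<in> carrier A \<rightarrow>\<^sub>E carrier B.
      (\<forall>x\<in>carrier A. \<forall>y\<in>carrier A. f (x \<oplus>\<^bsub>A\<^esub> y) = f x \<oplus>\<^bsub>B\<^esub> f y) \<and>
      (\<forall>k\<in>carrier K. \<forall>x\<in>carrier A. f (k \<odot>\<^bsub>A\<^esub> x) = k \<odot>\<^bsub>B\<^esub> f x) \<and>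
      (\<forall>x\<in>carrier A. \<forall>y\<in>carrier A. f (x \<otimes>\<^bsub>A\<^esub> y) = f x \<otimes>\<^bsub>B\<^esub> f y)}"


section \<open>$G_i$-associativity and the dual identities\<close>

definition associator :: "('k, 'a) module \<Rightarrow> 'a \<Rightarrow> 'a \<Rightarrow> 'a \<Rightarrow> 'a" where
  "associator A x y z = ((x \<otimes>\<^bsub>A\<^esub> y) \<otimes>\<^bsub>A\<^esub> z) \<ominus>\<^bsub>A\<^esub> (x \<otimes>\<^bsub>A\<^esub> (y \<otimes>\<^bsub>A\<^esub> z))"

definition Gsub :: "nat \<Rightarrow> (nat \<Rightarrow> nat) set" where
  "Gsub i =
    (if i = 1 then {id}
     else if i = 2 then {id, transpose 1 2}
     else if i = 3 then {id, transpose 2 3}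
     else if i = 4 then {id, transpose 1 3}
     else if i = 5 then carrier (alt_group 3)
     else carrier (sym_group 3))"

text \<open>
  A triple is a function \<open>x\<close> on \<open>{1, 2, 3}\<close>; then \<open>\<sigma> (x\<^sub>1, x\<^sub>2, x\<^sub>3)\<close> has \<open>j\<close>-th component
  \<open>x (\<sigma>\<^sup>-\<^sup>1 j)\<close>. The notation \<open>inv\<close> is taken by group inverses, hence \<open>inv_into UNIV\<close>.
\<close>

locale G_assoc_algebra = nonassoc_algebra K A for i :: nat and K and A +
  assumes G_assoc: "x \<in> {1, 2, 3} \<rightarrow> carrier A \<Longrightarrow>
    (\<Oplus>\<^bsub>A\<^esub>\<sigma>\<in>Gsub i. [sign \<sigma>] \<cdot>\<^bsub>A\<^esub> associator A (x (inv_into UNIV \<sigma> 1)) (x (inv_into UNIV \<sigma> 2)) (x (inv_into UNIV \<sigma> 3))) = \<zero>\<^bsub>A\<^esub>"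

text \<open>
  Algebras over the dual operad of $G_i$-$\mathcal{A}ss$. The products \<open>abc\<close> are bracketed to the
  left, which is immaterial by associativity.
\<close>

locale dual_G_assoc_algebra = nonassoc_algebra K B for i :: nat and K and B (structure) +
  assumes assoc: "\<lbrakk>a \<in> carrier B; b \<in> carrier B; c \<in> carrier B\<rbrakk>
      \<Longrightarrow> a \<otimes> b \<otimes> c = a \<otimes> (b \<otimes> c)"
    and dual2: "\<lbrakk>i = 2; a \<in> carrier B; b \<in> carrier B; c \<in> carrier B\<rbrakk>
      \<Longrightarrow> a \<otimes> b \<otimes> c = b \<otimes> a \<otimes> c"
    and dual3: "\<lbrakk>i = 3; a \<in> carrier B; b \<in> carrier B; c \<in> carrier B\<rbrakk>
      \<Longrightarrow> a \<otimes> b \<otimes> c = a \<otimes> c \<otimes> b"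
    and dual4: "\<lbrakk>i = 4; a \<in> carrier B; b \<in> carrier B; c \<in> carrier B\<rbrakk>
      \<Longrightarrow> a \<otimes> b \<otimes> c = c \<otimes> b \<otimes> a"
    and dual5: "\<lbrakk>i = 5; a \<in> carrier B; b \<in> carrier B; c \<in> carrier B\<rbrakk>
      \<Longrightarrow> a \<otimes> b \<otimes> c = b \<otimes> c \<otimes> a \<and> b \<otimes> c \<otimes> a = c \<otimes> a \<otimes> b"
    and dual6: "\<lbrakk>i = 6; a \<in> carrier B; b \<in> carrier B; c \<in> carrier B\<rbrakk>
      \<Longrightarrow> a \<otimes> b \<otimes> c = a \<otimes> c \<otimes> b \<and> a \<otimes> c \<otimes> b = b \<otimes> a \<otimes> c"


section \<open>Categories and functors\<close>

text \<open>
  Hom-sets are indexed by source and target, and composition \<open>Comp C X Y Z g f\<close> is that of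
  \<open>f : X \<rightarrow> Y\<close> with \<open>g : Y \<rightarrow> Z\<close>. The same \<open>'m\<close> may represent morphisms between different objects.
\<close>

record ('o, 'm) cat =
  Obj :: "'o set"
  Hom :: "'o \<Rightarrow> 'o \<Rightarrow> 'm set"
  Ident :: "'o \<Rightarrow> 'm"
  Comp :: "'o \<Rightarrow> 'o \<Rightarrow> 'o \<Rightarrow> 'm \<Rightarrow> 'm \<Rightarrow> 'm"

locale category =
  fixes C :: "('o, 'm) cat"
  assumes ident_hom: "X \<in> Obj C \<Longrightarrow> Ident C X \<in> Hom C X X"
    and comp_hom: "\<lbrakk>X \<in> Obj C; Y \<in> Obj C; Z \<in> Obj C; f \<in> Hom C X Y; g \<in> Hom C Y Z\<rbrakk>
      \<Longrightarrow> Comp C X Y Z g f \<in> Hom C X Z"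
    and comp_ident_right: "\<lbrakk>X \<in> Obj C; Y \<in> Obj C; f \<in> Hom C X Y\<rbrakk>
      \<Longrightarrow> Comp C X X Y f (Ident C X) = f"
    and comp_ident_left: "\<lbrakk>X \<in> Obj C; Y \<in> Obj C; f \<in> Hom C X Y\<rbrakk>
      \<Longrightarrow> Comp C X Y Y (Ident C Y) f = f"
    and comp_assoc: "\<lbrakk>W \<in> Obj C; X \<in> Obj C; Y \<in> Obj C; Z \<in> Obj C;
        f \<in> Hom C W X; g \<in> Hom C X Y; h \<in> Hom C Y Z\<rbrakk>
      \<Longrightarrow> Comp C W X Z (Comp C X Y Z h g) f = Comp C W Y Z h (Comp C W X Y g f)"

locale covariant_functor = C: category C + D: category D
  for C :: "('o, 'm) cat" and D :: "('p, 'n) cat" +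
  fixes F_obj :: "'o \<Rightarrow> 'p"
    and F_map :: "'o \<Rightarrow> 'o \<Rightarrow> 'm \<Rightarrow> 'n"
  assumes F_obj: "X \<in> Obj C \<Longrightarrow> F_obj X \<in> Obj D"
    and F_map: "\<lbrakk>X \<in> Obj C; Y \<in> Obj C; f \<in> Hom C X Y\<rbrakk>
      \<Longrightarrow> F_map X Y f \<in> Hom D (F_obj X) (F_obj Y)"
    and F_ident: "X \<in> Obj C \<Longrightarrow> F_map X X (Ident C X) = Ident D (F_obj X)"
    and F_comp: "\<lbrakk>X \<in> Obj C; Y \<in> Obj C; Z \<in> Obj C; f \<in> Hom C X Y; g \<in> Hom C Y Z\<rbrakk>
      \<Longrightarrow> F_map X Z (Comp C X Y Z g f)
          = Comp D (F_obj X) (F_obj Y) (F_obj Z) (F_map Y Z g) (F_map X Y f)"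

definition alg_id :: "('k, 'a) module \<Rightarrow> 'a \<Rightarrow> 'a" where
  "alg_id A = (\<lambda>x\<in>carrier A. x)"

definition alg_cat ::
    "('k, 'm) ring_scheme \<Rightarrow> ('k, 'a) module set \<Rightarrow> (('k, 'a) module, 'a \<Rightarrow> 'a) cat" where
  "alg_cat K S =
    \<lparr>Obj = S, Hom = alg_hom K, Ident = alg_id, Comp = (\<lambda>X Y Z. compose (carrier X))\<rparr>"

definition G_ASS ::
    "nat \<Rightarrow> ('k, 'm) ring_scheme \<Rightarrow> (('k, 'a) module, 'a \<Rightarrow> 'a) cat" where
  "G_ASS i K = alg_cat K {A. G_assoc_algebra i K A}"

definition G_ASS_dual ::
    "nat \<Rightarrow> ('k, 'm) ring_scheme \<Rightarrow> (('k, 'a) module, 'a \<Rightarrow> 'a) cat" where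
  "G_ASS_dual i K = alg_cat K {B. dual_G_assoc_algebra i K B}"


section \<open>The tensor product\<close>

definition basis_vec :: "('k, 'm) ring_scheme \<Rightarrow> 'p \<Rightarrow> 'p \<Rightarrow> 'k" where
  "basis_vec K p = (\<lambda>q. if q = p then \<one>\<^bsub>K\<^esub> else \<zero>\<^bsub>K\<^esub>)"

text \<open>
  The free \<open>K\<close>-module on \<open>carrier A \<times> carrier B\<close>, with the bilinear product that sends the basis
  vectors of \<open>(a, b)\<close> and \<open>(a', b')\<close> to the basis vector of \<open>(aa', bb')\<close>. (The field name is qualified because \<open>mult\<close> also names an order on multisets.)
\<close>

definition free_alg ::
    "('k, 'm) ring_scheme \<Rightarrow> ('k, 'a) module \<Rightarrow> ('k, 'b) module \<Rightarrow> ('k, 'a \<times> 'b \<Rightarrow> 'k) module" where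
  "free_alg K A B =
    \<lparr>carrier = {x. range x \<subseteq> carrier K \<and> finite {p. x p \<noteq> \<zero>\<^bsub>K\<^esub>} \<and>
        {p. x p \<noteq> \<zero>\<^bsub>K\<^esub>} \<subseteq> carrier A \<times> carrier B},
     monoid.mult = (\<lambda>x y r. finsum K (\<lambda>(p, q). x p \<otimes>\<^bsub>K\<^esub> y q)
        {(p, q). x p \<noteq> \<zero>\<^bsub>K\<^esub> \<and> y q \<noteq> \<zero>\<^bsub>K\<^esub> \<and>
          (fst p \<otimes>\<^bsub>A\<^esub> fst q, snd p \<otimes>\<^bsub>B\<^esub> snd q) = r}),
     one = basis_vec K (\<one>\<^bsub>A\<^esub>, \<one>\<^bsub>B\<^esub>),
     zero = (\<lambda>p. \<zero>\<^bsub>K\<^esub>),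
     add = (\<lambda>x y p. x p \<oplus>\<^bsub>K\<^esub> y p),
     smult = (\<lambda>k x p. k \<otimes>\<^bsub>K\<^esub> x p)\<rparr>"

definition bilinear_relators ::
    "('k, 'm) ring_scheme \<Rightarrow> ('k, 'a) module \<Rightarrow> ('k, 'b) module \<Rightarrow> ('a \<times> 'b \<Rightarrow> 'k) set" where
  "bilinear_relators K A B =
    (let M = free_alg K A B; e = (\<lambda>a b. basis_vec K (a, b)) in
      {e (a \<oplus>\<^bsub>A\<^esub> a') b \<ominus>\<^bsub>M\<^esub> (e a b \<oplus>\<^bsub>M\<^esub> e a' b) | a a' b.
        a \<in> carrier A \<and> a' \<in> carrier A \<and> b \<in> carrier B} \<union>
      {e a (b \<oplus>\<^bsub>B\<^esub> b') \<ominus>\<^bsub>M\<^esub> (e a b \<oplus>\<^bsub>M\<^esub> e a b') | a b b'.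
        a \<in> carrier A \<and> b \<in> carrier B \<and> b' \<in> carrier B} \<union>
      {e (k \<odot>\<^bsub>A\<^esub> a) b \<ominus>\<^bsub>M\<^esub> (k \<odot>\<^bsub>M\<^esub> e a b) | k a b.
        k \<in> carrier K \<and> a \<in> carrier A \<and> b \<in> carrier B} \<union>
      {e a (k \<odot>\<^bsub>B\<^esub> b) \<ominus>\<^bsub>M\<^esub> (k \<odot>\<^bsub>M\<^esub> e a b) | k a b.
        k \<in> carrier K \<and> a \<in> carrier A \<and> b \<in> carrier B})"

definition tensor_null ::
    "('k, 'm) ring_scheme \<Rightarrow> ('k, 'a) module \<Rightarrow> ('k, 'b) module \<Rightarrow> ('a \<times> 'b \<Rightarrow> 'k) set" where
  "tensor_null K A B =
    \<Inter> {H. submodule H K (free_alg K A B) \<and> bilinear_relators K A B \<subseteq> H}"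

definition tensor ::
    "('k, 'm) ring_scheme \<Rightarrow> ('k, 'a) module \<Rightarrow> ('k, 'b) module
      \<Rightarrow> ('k, ('a \<times> 'b \<Rightarrow> 'k) set) module" where
  "tensor K A B =
    (let M = free_alg K A B; N = tensor_null K A B in
      \<lparr>carrier = a_rcosets\<^bsub>M\<^esub> N, monoid.mult = rcoset_mult M N, one = N +>\<^bsub>M\<^esub> \<one>\<^bsub>M\<^esub>, zero = N,
       add = set_add M, smult = (\<lambda>k X. \<Union>x\<in>X. N +>\<^bsub>M\<^esub> (k \<odot>\<^bsub>M\<^esub> x))\<rparr>)"

definition elem_tensor ::
    "('k, 'm) ring_scheme \<Rightarrow> ('k, 'a) module \<Rightarrow> ('k, 'b) module \<Rightarrow> 'a \<Rightarrow> 'b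
      \<Rightarrow> ('a \<times> 'b \<Rightarrow> 'k) set" where
  "elem_tensor K A B a b = tensor_null K A B +>\<^bsub>free_alg K A B\<^esub> basis_vec K (a, b)"

text \<open>The linear map of free modules that extends a map \<open>h\<close> of the bases.\<close>

definition free_map ::
    "('k, 'm) ring_scheme \<Rightarrow> ('p \<Rightarrow> 'q) \<Rightarrow> ('p \<Rightarrow> 'k) \<Rightarrow> 'q \<Rightarrow> 'k" where
  "free_map K h x = (\<lambda>q. \<Oplus>\<^bsub>K\<^esub>p\<in>{p. x p \<noteq> \<zero>\<^bsub>K\<^esub> \<and> h p = q}. x p)"

definition tensor_map ::
    "('k, 'm) ring_scheme \<Rightarrow> ('k, 'a) module \<Rightarrow> ('k, 'b) module
      \<Rightarrow> ('k, 'c) module \<Rightarrow> ('k, 'd) module \<Rightarrow> ('a \<Rightarrow> 'c) \<Rightarrow> ('b \<Rightarrow> 'd)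
      \<Rightarrow> ('a \<times> 'b \<Rightarrow> 'k) set \<Rightarrow> ('c \<times> 'd \<Rightarrow> 'k) set" where
  "tensor_map K A B A' B' g f =
    (\<lambda>X\<in>carrier (tensor K A B).
      \<Union>x\<in>X. tensor_null K A' B' +>\<^bsub>free_alg K A' B'\<^esub> free_map K (map_prod g f) x)"

end

theory Submission
  imports Defs
begin

text \<open>
  On pure tensors the associator of \<open>A \<otimes> B\<close> is a pure tensor, because \<open>B\<close> is associative:
  \<open>assoc (a\<^sub>1 \<otimes> b\<^sub>1) (a\<^sub>2 \<otimes> b\<^sub>2) (a\<^sub>3 \<otimes> b\<^sub>3) = assoc a\<^sub>1 a\<^sub>2 a\<^sub>3 \<otimes> b\<^sub>1 b\<^sub>2 b\<^sub>3\<close>. The dual identities say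
  exactly that \<open>b\<^sub>1 b\<^sub>2 b\<^sub>3\<close> does not change when its factors are permuted by an element of \<open>G\<^sub>i\<close>
  (\<open>product_Gsub_invariant\<close>). The alternating sum over \<open>G\<^sub>i\<close> is therefore the corresponding sum
  in \<open>A\<close>, which vanishes, tensored with \<open>b\<^sub>1 b\<^sub>2 b\<^sub>3\<close>. This sum is additive in each argument
  and pure tensors generate \<open>A \<otimes> B\<close> additively, so it vanishes everywhere
  (\<open>tensor_G_assoc_algebra\<close>).

  The product on \<open>A \<otimes> B\<close> comes from the bilinear product of the free module on the pairs. It descends
  to the quotient because the submodule spanned by the bilinearity relators is an ideal
  (\<open>null_mult\<close>): multiplying a relator by a basis vector gives a relator, by bilinearity of the
  products of \<open>A\<close> and \<open>B\<close>. In the same way the linear map that two homomorphisms induce on the free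
  modules sends relators to relators, and so induces a map of tensor products
  (\<open>tensor_map_alg_hom\<close>).

  Homomorphisms out of \<open>A \<otimes> B\<close> are determined by their values on pure tensors (\<open>alg_hom_eqI\<close>),
  which reduces the two functor laws to \<open>(Id \<otimes> f) (a \<otimes> b) = a \<otimes> f b\<close>.
\<close>

section \<open>Linear maps\<close>

locale linear_map = V: module K V + W: module K W
  for K :: "('k, 'm) ring_scheme" and V :: "('k, 'a, 'v) module_scheme"
    and W :: "('k, 'b, 'w) module_scheme" and \<phi> :: "'a \<Rightarrow> 'b" +
  assumes closed: "x \<in> carrier V \<Longrightarrow> \<phi> x \<in> carrier W"
    and add: "\<lbrakk>x \<in> carrier V; y \<in> carrier V\<rbrakk> \<Longrightarrow> \<phi> (x \<oplus>\<^bsub>V\<^esub> y) = \<phi> x \<oplus>\<^bsub>W\<^esub> \<phi> y"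
    and smult: "\<lbrakk>k \<in> carrier K; x \<in> carrier V\<rbrakk> \<Longrightarrow> \<phi> (k \<odot>\<^bsub>V\<^esub> x) = k \<odot>\<^bsub>W\<^esub> \<phi> x"
begin

lemma zero: "\<phi> \<zero>\<^bsub>V\<^esub> = \<zero>\<^bsub>W\<^esub>"
  using smult[of "\<zero>\<^bsub>K\<^esub>" "\<zero>\<^bsub>V\<^esub>"] by (simp add: closed)

lemma neg:
  assumes "x \<in> carrier V"
  shows "\<phi> (\<ominus>\<^bsub>V\<^esub> x) = \<ominus>\<^bsub>W\<^esub> \<phi> x"
proof -
  have "\<phi> (\<ominus>\<^bsub>V\<^esub> x) \<oplus>\<^bsub>W\<^esub> \<phi> x = \<zero>\<^bsub>W\<^esub>"
    using add[of "\<ominus>\<^bsub>V\<^esub> x" x] assms by (simp add: V.l_neg zero)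
  then show ?thesis
    using assms closed by (simp add: W.minus_equality)
qed

lemma minus:
  "\<lbrakk>x \<in> carrier V; y \<in> carrier V\<rbrakk> \<Longrightarrow> \<phi> (x \<ominus>\<^bsub>V\<^esub> y) = \<phi> x \<ominus>\<^bsub>W\<^esub> \<phi> y"
  by (simp add: a_minus_def add neg)

lemma submodule_vimage:
  assumes "submodule H K W"
  shows "submodule {x \<in> carrier V. \<phi> x \<in> H} K V"
  using W.submoduleE[OF assms]
  by (intro V.submoduleI)
    (auto simp: add neg smult zero
      intro: subgroup.one_closed[OF submodule.axioms(1)[OF assms], simplified])

end

lemma (in nonassoc_algebra) linear_map_mult_left:
  "y \<in> carrier A \<Longrightarrow> linear_map K A A (\<lambda>x. x \<otimes> y)"
  by (intro linear_map.intro linear_map_axioms.intro module_axioms)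
    (simp_all add: mult_closed mult_add_left mult_smult_left)

lemma (in nonassoc_algebra) linear_map_mult_right:
  "y \<in> carrier A \<Longrightarrow> linear_map K A A (\<lambda>x. y \<otimes> x)"
  by (intro linear_map.intro linear_map_axioms.intro module_axioms)
    (simp_all add: mult_closed mult_add_right mult_smult_right)

lemma (in linear_map) finsum:
  assumes "f \<in> S \<rightarrow> carrier V"
  shows "\<phi> (finsum V f S) = finsum W (\<lambda>s. \<phi> (f s)) S"
  using assms
proof (induction S rule: infinite_finite_induct)
  case (insert s S)
  then show ?case
    by (simp add: add closed Pi_iff)
qed (simp_all add: zero)

lemma (in linear_map) int_multiple:
  assumes "x \<in> carrier V"
  shows "\<phi> ([n] \<cdot>\<^bsub>V\<^esub> x) = [(n::int)] \<cdot>\<^bsub>W\<^esub> \<phi> x"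
proof -
  interpret h: group_hom "add_monoid V" "add_monoid W" \<phi>
    by (intro group_hom.intro group_hom_axioms.intro homI V.a_group W.a_group)
      (simp_all add: closed add)
  show ?thesis
    using h.hom_int_pow[of x n] assms by (simp add: add_pow_def)
qed

section \<open>The free algebra on pairs\<close>

locale tensor_pair = field K + A: nonassoc_algebra K A + B: nonassoc_algebra K B
  for K :: "('k, 'm) ring_scheme" (structure)
    and A :: "('k, 'a) module" and B :: "('k, 'b) module"
begin

abbreviation M where "M \<equiv> free_alg K A B"
abbreviation N where "N \<equiv> tensor_null K A B"
abbreviation Q where "Q \<equiv> tensor K A B"
abbreviation e where "e a b \<equiv> basis_vec K (a, b)"
abbreviation pure (infixl \<open>\<otimes>\<otimes>\<close> 75) where "a \<otimes>\<otimes> b \<equiv> elem_tensor K A B a b"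
abbreviation pmult where
  "pmult p q \<equiv> (fst p \<otimes>\<^bsub>A\<^esub> fst q, snd p \<otimes>\<^bsub>B\<^esub> snd q)"

definition supp :: "('p \<Rightarrow> 'k) \<Rightarrow> 'p set" where "supp x = {p. x p \<noteq> \<zero>}"

lemma free_carrier:
  "x \<in> carrier M \<longleftrightarrow> (\<forall>p. x p \<in> carrier K) \<and> finite (supp x) \<and> supp x \<subseteq> carrier A \<times> carrier B"
  by (auto simp: free_alg_def supp_def)

lemma free_coeff: "x \<in> carrier M \<Longrightarrow> x p \<in> carrier K"
  using free_carrier by blast

lemma free_finite_supp: "x \<in> carrier M \<Longrightarrow> finite (supp x)"
  by (simp add: free_carrier)

lemma free_supp: "\<lbrakk>x \<in> carrier M; p \<in> supp x\<rbrakk> \<Longrightarrow> p \<in> carrier A \<times> carrier B"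
  by (auto simp: free_carrier)

lemma free_add: "x \<oplus>\<^bsub>M\<^esub> y = (\<lambda>p. x p \<oplus> y p)"
  and free_zero: "\<zero>\<^bsub>M\<^esub> = (\<lambda>p. \<zero>)"
  and free_smult: "k \<odot>\<^bsub>M\<^esub> x = (\<lambda>p. k \<otimes> x p)"
  by (simp_all add: free_alg_def)

lemma supp_add: "supp (x \<oplus>\<^bsub>M\<^esub> y) \<subseteq> supp x \<union> supp y"
  by (auto simp: supp_def free_add)

lemma supp_smult: "k \<in> carrier K \<Longrightarrow> supp (k \<odot>\<^bsub>M\<^esub> x) \<subseteq> supp x"
  by (auto simp: supp_def free_smult)

lemma free_add_closed:
  "\<lbrakk>x \<in> carrier M; y \<in> carrier M\<rbrakk> \<Longrightarrow> x \<oplus>\<^bsub>M\<^esub> y \<in> carrier M"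
  using supp_add[of x y] unfolding free_carrier
  by (auto simp: free_add intro: finite_subset)

lemma free_smult_closed:
  "\<lbrakk>k \<in> carrier K; x \<in> carrier M\<rbrakk> \<Longrightarrow> k \<odot>\<^bsub>M\<^esub> x \<in> carrier M"
  using supp_smult[of k x] unfolding free_carrier
  by (auto simp: free_smult intro: finite_subset)

lemma free_zero_closed: "\<zero>\<^bsub>M\<^esub> \<in> carrier M"
  by (simp add: free_carrier free_zero supp_def)

lemma free_module: "module K M"
proof (intro moduleI abelian_groupI)
  fix x assume x: "x \<in> carrier M"
  have "(\<ominus> \<one> \<odot>\<^bsub>M\<^esub> x) \<oplus>\<^bsub>M\<^esub> x = \<zero>\<^bsub>M\<^esub>"
    using free_coeff[OF x] by (simp add: fun_eq_iff free_add free_smult free_zero l_minus l_neg)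
  then show "\<exists>y\<in>carrier M. y \<oplus>\<^bsub>M\<^esub> x = \<zero>\<^bsub>M\<^esub>"
    using x free_smult_closed[of "\<ominus> \<one>" x] by auto
qed (simp_all add: is_cring free_add_closed free_smult_closed free_zero_closed,
    simp_all add: free_coeff fun_eq_iff free_add free_smult free_zero a_ac m_assoc l_distr r_distr)

sublocale M: module K M
  by (rule free_module)

lemma basis_closed [simp]: "\<lbrakk>a \<in> carrier A; b \<in> carrier B\<rbrakk> \<Longrightarrow> e a b \<in> carrier M"
  by (auto simp: free_carrier basis_vec_def supp_def)

lemma supp_basis: "supp (basis_vec K p) = {p}"
  by (auto simp: supp_def basis_vec_def)

lemma free_induct [consumes 1, case_names zero smult_basis add]:
  assumes "x \<in> carrier M"
    and zero: "P \<zero>\<^bsub>M\<^esub>"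
    and basis: "\<And>k a b. \<lbrakk>k \<in> carrier K; a \<in> carrier A; b \<in> carrier B\<rbrakk> \<Longrightarrow> P (k \<odot>\<^bsub>M\<^esub> e a b)"
    and add: "\<And>x y. \<lbrakk>x \<in> carrier M; y \<in> carrier M; P x; P y\<rbrakk> \<Longrightarrow> P (x \<oplus>\<^bsub>M\<^esub> y)"
  shows "P x"
proof -
  have "finite S \<Longrightarrow> x \<in> carrier M \<Longrightarrow> supp x \<subseteq> S \<Longrightarrow> P x" for S x
  proof (induction S arbitrary: x rule: finite_induct)
    case empty
    then have "x = \<zero>\<^bsub>M\<^esub>"
      by (auto simp: fun_eq_iff free_zero supp_def)
    then show ?case
      by (simp add: zero)
  next
    case (insert p S)
    show ?case
    proof (cases "p \<in> supp x")
      case False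
      then show ?thesis
        using insert by blast
    next
      case True
      obtain a b where p: "p = (a, b)" "a \<in> carrier A" "b \<in> carrier B"
        using free_supp[OF insert.prems(1) True] by auto
      \<comment> \<open>Split off the term at \<open>p\<close>; the rest has its support in \<open>S\<close>.\<close>
      define y where "y = x(p := \<zero>)"
      have y: "y \<in> carrier M" "supp y \<subseteq> S"
        using insert.prems by (auto simp: y_def free_carrier supp_def elim: rev_finite_subset)
      have "x = (x p \<odot>\<^bsub>M\<^esub> e a b) \<oplus>\<^bsub>M\<^esub> y"
        using free_coeff[OF insert.prems(1)]
        by (auto simp: y_def fun_eq_iff free_add free_smult basis_vec_def p)
      moreover have "P ((x p \<odot>\<^bsub>M\<^esub> e a b) \<oplus>\<^bsub>M\<^esub> y)"
        using p y
        by (intro add basis insert.IH free_smult_closed basis_closed free_coeff insert.prems(1))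
      ultimately show ?thesis
        by simp
    qed
  qed
  then show ?thesis
    using assms(1) free_finite_supp[OF assms(1)] by blast
qed

text \<open>
  The sum that defines a coefficient of a product runs over a set that depends on both factors.
  Summing over a fixed rectangle instead makes the sums for different factors comparable, so that
  bilinearity of the product becomes additivity and distributivity of finite sums.
\<close>

lemma free_mult_on:
  assumes "x \<in> carrier M" "y \<in> carrier M" "finite S" "finite T" "supp x \<subseteq> S" "supp y \<subseteq> T"
  shows "(x \<otimes>\<^bsub>M\<^esub> y) r =
    finsum K (\<lambda>(p, q). if pmult p q = r then x p \<otimes> y q else \<zero>) (S \<times> T)"
proof -
  have "(x \<otimes>\<^bsub>M\<^esub> y) r = finsum K (\<lambda>(p, q). x p \<otimes> y q)
      {(p, q). x p \<noteq> \<zero> \<and> y q \<noteq> \<zero> \<and> pmult p q = r}"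
    by (simp add: free_alg_def)
  also have "\<dots> = finsum K (\<lambda>(p, q). if pmult p q = r then x p \<otimes> y q else \<zero>) (S \<times> T)"
    by (rule add.finprod_mono_neutral_cong_left)
      (use assms free_coeff[OF assms(1)] free_coeff[OF assms(2)] in
        \<open>auto simp: supp_def split: if_splits\<close>)
  finally show ?thesis .
qed

lemma free_mult_closed:
  assumes "x \<in> carrier M" "y \<in> carrier M"
  shows "x \<otimes>\<^bsub>M\<^esub> y \<in> carrier M"
proof -
  have *: "(x \<otimes>\<^bsub>M\<^esub> y) r =
      finsum K (\<lambda>(p, q). if pmult p q = r then x p \<otimes> y q else \<zero>) (supp x \<times> supp y)" for r
    using assms by (intro free_mult_on) (auto simp: free_finite_supp)
  have "supp (x \<otimes>\<^bsub>M\<^esub> y) \<subseteq> (\<lambda>(p, q). pmult p q) ` (supp x \<times> supp y)"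
  proof
    fix r assume "r \<in> supp (x \<otimes>\<^bsub>M\<^esub> y)"
    moreover have "(x \<otimes>\<^bsub>M\<^esub> y) r = \<zero>" if "\<not> (\<exists>p\<in>supp x. \<exists>q\<in>supp y. pmult p q = r)"
      unfolding * using that by (intro add.finprod_one_eqI) force
    ultimately show "r \<in> (\<lambda>(p, q). pmult p q) ` (supp x \<times> supp y)"
      by (force simp: supp_def)
  qed
  moreover have "(\<lambda>(p, q). pmult p q) ` (supp x \<times> supp y) \<subseteq> carrier A \<times> carrier B"
    using assms free_supp by (fastforce intro: A.mult_closed B.mult_closed)
  moreover have "(x \<otimes>\<^bsub>M\<^esub> y) r \<in> carrier K" for r
    unfolding * using free_coeff[OF assms(1)] free_coeff[OF assms(2)]
    by (intro finsum_closed) auto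
  ultimately show ?thesis
    unfolding free_carrier using assms free_finite_supp
    by (meson finite_SigmaI finite_imageI finite_subset subset_trans)
qed

lemma free_nonassoc_algebra: "nonassoc_algebra K M"
proof (intro nonassoc_algebra.intro nonassoc_algebra_axioms.intro free_module)
  fix x y assume xy: "x \<in> carrier M" "y \<in> carrier M"
  note [simp] = free_coeff[OF xy(1)] free_coeff[OF xy(2)]
  note fin = free_finite_supp[OF xy(1)] free_finite_supp[OF xy(2)]
  show "x \<otimes>\<^bsub>M\<^esub> y \<in> carrier M"
    using xy by (rule free_mult_closed)
  {
    fix k assume k: "k \<in> carrier K"
    let ?s = "\<lambda>r (p, q). if pmult p q = r then x p \<otimes> y q else \<zero>"
    have s: "?s r \<in> supp x \<times> supp y \<rightarrow> carrier K" for r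
      using xy by auto
    have 1: "(k \<odot>\<^bsub>M\<^esub> (x \<otimes>\<^bsub>M\<^esub> y)) r = finsum K (\<lambda>pq. k \<otimes> ?s r pq) (supp x \<times> supp y)" for r
      unfolding free_smult free_mult_on[OF xy fin order_refl order_refl]
      by (rule finsum_rdistr[OF _ k s]) (simp add: fin)
    show "(k \<odot>\<^bsub>M\<^esub> x) \<otimes>\<^bsub>M\<^esub> y = k \<odot>\<^bsub>M\<^esub> (x \<otimes>\<^bsub>M\<^esub> y)"
    proof
      fix r
      have "((k \<odot>\<^bsub>M\<^esub> x) \<otimes>\<^bsub>M\<^esub> y) r =
          finsum K (\<lambda>(p, q). if pmult p q = r then (k \<odot>\<^bsub>M\<^esub> x) p \<otimes> y q else \<zero>) (supp x \<times> supp y)"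
        by (intro free_mult_on free_smult_closed supp_smult k xy fin order_refl)
      also have "\<dots> = (k \<odot>\<^bsub>M\<^esub> (x \<otimes>\<^bsub>M\<^esub> y)) r"
        unfolding 1 using xy k by (intro finsum_cong') (auto simp: free_smult m_assoc)
      finally show "((k \<odot>\<^bsub>M\<^esub> x) \<otimes>\<^bsub>M\<^esub> y) r = (k \<odot>\<^bsub>M\<^esub> (x \<otimes>\<^bsub>M\<^esub> y)) r" .
    qed
    show "x \<otimes>\<^bsub>M\<^esub> (k \<odot>\<^bsub>M\<^esub> y) = k \<odot>\<^bsub>M\<^esub> (x \<otimes>\<^bsub>M\<^esub> y)"
    proof
      fix r
      have "(x \<otimes>\<^bsub>M\<^esub> (k \<odot>\<^bsub>M\<^esub> y)) r =
          finsum K (\<lambda>(p, q). if pmult p q = r then x p \<otimes> (k \<odot>\<^bsub>M\<^esub> y) q else \<zero>) (supp x \<times> supp y)"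
        by (intro free_mult_on free_smult_closed supp_smult k xy fin order_refl)
      also have "\<dots> = (k \<odot>\<^bsub>M\<^esub> (x \<otimes>\<^bsub>M\<^esub> y)) r"
        unfolding 1 using xy k by (intro finsum_cong') (auto simp: free_smult m_lcomm)
      finally show "(x \<otimes>\<^bsub>M\<^esub> (k \<odot>\<^bsub>M\<^esub> y)) r = (k \<odot>\<^bsub>M\<^esub> (x \<otimes>\<^bsub>M\<^esub> y)) r" .
    qed
  }
  fix z assume z: "z \<in> carrier M"
  note [simp] = free_coeff[OF z]
  note fin' = fin free_finite_supp[OF z]
  show "(x \<oplus>\<^bsub>M\<^esub> y) \<otimes>\<^bsub>M\<^esub> z = (x \<otimes>\<^bsub>M\<^esub> z) \<oplus>\<^bsub>M\<^esub> (y \<otimes>\<^bsub>M\<^esub> z)"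
  proof
    fix r
    let ?S = "supp x \<union> supp y"
    let ?s = "\<lambda>u. \<lambda>(p, q). if pmult p q = r then u p \<otimes> z q else \<zero>"
    have m: "(u \<otimes>\<^bsub>M\<^esub> z) r = finsum K (?s u) (?S \<times> supp z)"
      if "u \<in> {x, y, x \<oplus>\<^bsub>M\<^esub> y}" for u
      using that xy z fin' supp_add[of x y] by (intro free_mult_on) auto
    have "(?s (x \<oplus>\<^bsub>M\<^esub> y)) = (\<lambda>pq. ?s x pq \<oplus> ?s y pq)"
      using xy z by (auto simp: fun_eq_iff free_add l_distr)
    then show "((x \<oplus>\<^bsub>M\<^esub> y) \<otimes>\<^bsub>M\<^esub> z) r = ((x \<otimes>\<^bsub>M\<^esub> z) \<oplus>\<^bsub>M\<^esub> (y \<otimes>\<^bsub>M\<^esub> z)) r"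
      unfolding free_add[of "_ \<otimes>\<^bsub>M\<^esub> _"] using xy z
      by (simp add: m) (rule finsum_addf; auto)
  qed
  show "z \<otimes>\<^bsub>M\<^esub> (x \<oplus>\<^bsub>M\<^esub> y) = (z \<otimes>\<^bsub>M\<^esub> x) \<oplus>\<^bsub>M\<^esub> (z \<otimes>\<^bsub>M\<^esub> y)"
  proof
    fix r
    let ?S = "supp x \<union> supp y"
    let ?s = "\<lambda>u. \<lambda>(p, q). if pmult p q = r then z p \<otimes> u q else \<zero>"
    have m: "(z \<otimes>\<^bsub>M\<^esub> u) r = finsum K (?s u) (supp z \<times> ?S)"
      if "u \<in> {x, y, x \<oplus>\<^bsub>M\<^esub> y}" for u
      using that xy z fin' supp_add[of x y] by (intro free_mult_on) auto
    have "(?s (x \<oplus>\<^bsub>M\<^esub> y)) = (\<lambda>pq. ?s x pq \<oplus> ?s y pq)"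
      using xy z by (auto simp: fun_eq_iff free_add r_distr)
    then show "(z \<otimes>\<^bsub>M\<^esub> (x \<oplus>\<^bsub>M\<^esub> y)) r = ((z \<otimes>\<^bsub>M\<^esub> x) \<oplus>\<^bsub>M\<^esub> (z \<otimes>\<^bsub>M\<^esub> y)) r"
      unfolding free_add[of "_ \<otimes>\<^bsub>M\<^esub> _"] using xy z
      by (simp add: m) (rule finsum_addf; auto)
  qed
qed

sublocale M: nonassoc_algebra K M
  by (rule free_nonassoc_algebra)

lemma basis_mult:
  assumes "a \<in> carrier A" "b \<in> carrier B" "a' \<in> carrier A" "b' \<in> carrier B"
  shows "e a b \<otimes>\<^bsub>M\<^esub> e a' b' = e (a \<otimes>\<^bsub>A\<^esub> a') (b \<otimes>\<^bsub>B\<^esub> b')"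
proof
  fix r
  show "(e a b \<otimes>\<^bsub>M\<^esub> e a' b') r = e (a \<otimes>\<^bsub>A\<^esub> a') (b \<otimes>\<^bsub>B\<^esub> b') r"
    using assms by (subst free_mult_on[of _ _ "{(a, b)}" "{(a', b')}"])
      (simp_all add: supp_basis, simp_all add: basis_vec_def)
qed

section \<open>The tensor product as a quotient algebra\<close>

lemma null_submodule: "submodule N K M"
proof -
  have sub: "H \<subseteq> carrier M" "\<zero>\<^bsub>M\<^esub> \<in> H" if "submodule H K M" for H
    using M.submoduleE(1)[OF that] subgroup.one_closed[OF submodule.axioms(1)[OF that]] by auto
  have "bilinear_relators K A B \<subseteq> carrier M"
    by (auto simp: bilinear_relators_def Let_def)
  then have "N \<subseteq> carrier M"
    using M.carrier_is_submodule unfolding tensor_null_def by blast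
  then show ?thesis
    by (rule M.submoduleI)
      (auto simp: tensor_null_def sub M.submoduleE)
qed

lemma
  shows relator_add_left:
      "\<lbrakk>a \<in> carrier A; a' \<in> carrier A; b \<in> carrier B\<rbrakk>
        \<Longrightarrow> e (a \<oplus>\<^bsub>A\<^esub> a') b \<ominus>\<^bsub>M\<^esub> (e a b \<oplus>\<^bsub>M\<^esub> e a' b) \<in> N"
    and relator_add_right:
      "\<lbrakk>a \<in> carrier A; b \<in> carrier B; b' \<in> carrier B\<rbrakk>
        \<Longrightarrow> e a (b \<oplus>\<^bsub>B\<^esub> b') \<ominus>\<^bsub>M\<^esub> (e a b \<oplus>\<^bsub>M\<^esub> e a b') \<in> N"
    and relator_smult_left:
      "\<lbrakk>k \<in> carrier K; a \<in> carrier A; b \<in> carrier B\<rbrakk>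
        \<Longrightarrow> e (k \<odot>\<^bsub>A\<^esub> a) b \<ominus>\<^bsub>M\<^esub> k \<odot>\<^bsub>M\<^esub> e a b \<in> N"
    and relator_smult_right:
      "\<lbrakk>k \<in> carrier K; a \<in> carrier A; b \<in> carrier B\<rbrakk>
        \<Longrightarrow> e a (k \<odot>\<^bsub>B\<^esub> b) \<ominus>\<^bsub>M\<^esub> k \<odot>\<^bsub>M\<^esub> e a b \<in> N"
proof -
  have null: "bilinear_relators K A B \<subseteq> N"
    unfolding tensor_null_def by blast
  show "\<lbrakk>a \<in> carrier A; a' \<in> carrier A; b \<in> carrier B\<rbrakk>
        \<Longrightarrow> e (a \<oplus>\<^bsub>A\<^esub> a') b \<ominus>\<^bsub>M\<^esub> (e a b \<oplus>\<^bsub>M\<^esub> e a' b) \<in> N"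
    by (rule subsetD[OF null]) (unfold bilinear_relators_def Let_def, blast)
  show "\<lbrakk>a \<in> carrier A; b \<in> carrier B; b' \<in> carrier B\<rbrakk>
        \<Longrightarrow> e a (b \<oplus>\<^bsub>B\<^esub> b') \<ominus>\<^bsub>M\<^esub> (e a b \<oplus>\<^bsub>M\<^esub> e a b') \<in> N"
    by (rule subsetD[OF null]) (unfold bilinear_relators_def Let_def, blast)
  show "\<lbrakk>k \<in> carrier K; a \<in> carrier A; b \<in> carrier B\<rbrakk>
        \<Longrightarrow> e (k \<odot>\<^bsub>A\<^esub> a) b \<ominus>\<^bsub>M\<^esub> k \<odot>\<^bsub>M\<^esub> e a b \<in> N"
    by (rule subsetD[OF null]) (unfold bilinear_relators_def Let_def, blast)
  show "\<lbrakk>k \<in> carrier K; a \<in> carrier A; b \<in> carrier B\<rbrakk>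
        \<Longrightarrow> e a (k \<odot>\<^bsub>B\<^esub> b) \<ominus>\<^bsub>M\<^esub> k \<odot>\<^bsub>M\<^esub> e a b \<in> N"
    by (rule subsetD[OF null]) (unfold bilinear_relators_def Let_def, blast)
qed

text \<open>
  The submodule \<open>N\<close> is the least one that contains the relators, so a linear map carries it into \<open>H\<close>
  as soon as it carries the relators into \<open>H\<close>. With \<open>W = M\<close> and \<open>H = N\<close> this shows that \<open>N\<close> is an
  ideal; with another free algebra as \<open>W\<close> it shows that maps descend to tensor products.
\<close>

lemma linear_map_null:
  assumes "linear_map K M W \<phi>" and H: "submodule H K W" and "x \<in> N"
    and add_left: "\<And>a a' b. \<lbrakk>a \<in> carrier A; a' \<in> carrier A; b \<in> carrier B\<rbrakk>
        \<Longrightarrow> \<phi> (e (a \<oplus>\<^bsub>A\<^esub> a') b) \<ominus>\<^bsub>W\<^esub> (\<phi> (e a b) \<oplus>\<^bsub>W\<^esub> \<phi> (e a' b)) \<in> H"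
    and add_right: "\<And>a b b'. \<lbrakk>a \<in> carrier A; b \<in> carrier B; b' \<in> carrier B\<rbrakk>
        \<Longrightarrow> \<phi> (e a (b \<oplus>\<^bsub>B\<^esub> b')) \<ominus>\<^bsub>W\<^esub> (\<phi> (e a b) \<oplus>\<^bsub>W\<^esub> \<phi> (e a b')) \<in> H"
    and smult_left: "\<And>k a b. \<lbrakk>k \<in> carrier K; a \<in> carrier A; b \<in> carrier B\<rbrakk>
        \<Longrightarrow> \<phi> (e (k \<odot>\<^bsub>A\<^esub> a) b) \<ominus>\<^bsub>W\<^esub> k \<odot>\<^bsub>W\<^esub> \<phi> (e a b) \<in> H"
    and smult_right: "\<And>k a b. \<lbrakk>k \<in> carrier K; a \<in> carrier A; b \<in> carrier B\<rbrakk>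
        \<Longrightarrow> \<phi> (e a (k \<odot>\<^bsub>B\<^esub> b)) \<ominus>\<^bsub>W\<^esub> k \<odot>\<^bsub>W\<^esub> \<phi> (e a b) \<in> H"
  shows "\<phi> x \<in> H"
proof -
  interpret \<phi>: linear_map K M W \<phi> by fact
  have "bilinear_relators K A B \<subseteq> {x \<in> carrier M. \<phi> x \<in> H}"
    by (auto simp: bilinear_relators_def Let_def \<phi>.minus \<phi>.add \<phi>.smult
        add_left add_right smult_left smult_right)
  with \<open>x \<in> N\<close> \<phi>.submodule_vimage[OF H] show ?thesis
    unfolding tensor_null_def by blast
qed

text \<open>
  \<open>N\<close> is a two-sided ideal. A product of a relator with a basis vector is again a relator, and the
  products with a fixed element of \<open>N\<close> that stay in \<open>N\<close> form a submodule.
\<close>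

lemma null_mult:
  assumes x: "x \<in> N" and y: "y \<in> carrier M"
  shows "x \<otimes>\<^bsub>M\<^esub> y \<in> N" "y \<otimes>\<^bsub>M\<^esub> x \<in> N"
proof -
  note E = M.submoduleE[OF null_submodule]
  have xM: "x \<in> carrier M"
    using x E(1) by blast
  have basis: "x \<otimes>\<^bsub>M\<^esub> e c d \<in> N \<and> e c d \<otimes>\<^bsub>M\<^esub> x \<in> N" if "c \<in> carrier A" "d \<in> carrier B" for c d
    using that
    by (intro conjI linear_map_null[OF M.linear_map_mult_left null_submodule x]
        linear_map_null[OF M.linear_map_mult_right null_submodule x])
      (simp_all add: basis_mult A.mult_closed B.mult_closed
        A.mult_add_left A.mult_add_right A.mult_smult_left A.mult_smult_right
        B.mult_add_left B.mult_add_right B.mult_smult_left B.mult_smult_right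
        relator_add_left relator_add_right relator_smult_left relator_smult_right)
  from y show "x \<otimes>\<^bsub>M\<^esub> y \<in> N"
  proof (induction y rule: free_induct)
    case zero
    show ?case
      using linear_map.zero[OF M.linear_map_mult_right[OF xM]]
        subgroup.one_closed[OF submodule.axioms(1)[OF null_submodule]] by simp
  qed (use xM E basis in \<open>simp_all add: M.mult_smult_right M.mult_add_right\<close>)
  from y show "y \<otimes>\<^bsub>M\<^esub> x \<in> N"
  proof (induction y rule: free_induct)
    case zero
    show ?case
      using linear_map.zero[OF M.linear_map_mult_left[OF xM]]
        subgroup.one_closed[OF submodule.axioms(1)[OF null_submodule]] by simp
  qed (use xM E basis in \<open>simp_all add: M.mult_smult_left M.mult_add_left\<close>)
qed

abbreviation coset where "coset x \<equiv> N +>\<^bsub>M\<^esub> x"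

lemma null_abelian_subgroup: "abelian_subgroup N M"
  by (intro abelian_subgroupI3 additive_subgroup.intro submodule.axioms(1)[OF null_submodule]
      M.abelian_group_axioms)

sublocale N: abelian_subgroup N M
  by (rule null_abelian_subgroup)

lemma coset_eqI: "\<lbrakk>x \<in> carrier M; y \<in> carrier M; y \<ominus>\<^bsub>M\<^esub> x \<in> N\<rbrakk> \<Longrightarrow> coset y = coset x"
  by (metis N.a_rcos_module N.a_repr_independence' a_minus_def)

text \<open>
  The operations of \<open>Q\<close>, and the maps between such quotients, are unions over all representatives of
  a coset. A function that is constant on the coset makes such a union collapse to that constant.
\<close>

lemma UN_coset:
  assumes "x \<in> carrier M"
    and "\<And>y. \<lbrakk>y \<in> carrier M; y \<ominus>\<^bsub>M\<^esub> x \<in> N\<rbrakk> \<Longrightarrow> f y = C"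
  shows "(\<Union>y\<in>coset x. f y) = C"
proof -
  have "f y = C" if "y \<in> coset x" for y
    using assms that N.a_elemrcos_carrier N.a_rcos_module
    by (metis a_minus_def)
  then show ?thesis
    using N.a_rcos_self[OF assms(1)] by auto
qed

lemma tensor_carrier: "carrier Q = coset ` carrier M"
  by (auto simp: tensor_def Let_def A_RCOSETS_def')

lemma tensor_carrierE:
  assumes "X \<in> carrier Q"
  obtains x where "x \<in> carrier M" "X = coset x"
  using assms by (auto simp: tensor_carrier)

lemma tensor_add:
  "\<lbrakk>x \<in> carrier M; y \<in> carrier M\<rbrakk> \<Longrightarrow> coset x \<oplus>\<^bsub>Q\<^esub> coset y = coset (x \<oplus>\<^bsub>M\<^esub> y)"
  by (simp add: tensor_def Let_def N.a_rcos_sum)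

lemma tensor_zero: "\<zero>\<^bsub>Q\<^esub> = coset \<zero>\<^bsub>M\<^esub>"
  using N.a_subset by (simp add: tensor_def Let_def)

lemma tensor_smult:
  assumes "k \<in> carrier K" "x \<in> carrier M"
  shows "k \<odot>\<^bsub>Q\<^esub> coset x = coset (k \<odot>\<^bsub>M\<^esub> x)"
proof -
  have "k \<odot>\<^bsub>M\<^esub> y \<ominus>\<^bsub>M\<^esub> k \<odot>\<^bsub>M\<^esub> x = k \<odot>\<^bsub>M\<^esub> (y \<ominus>\<^bsub>M\<^esub> x)" if "y \<in> carrier M" for y
    using assms that by (simp add: a_minus_def M.smult_r_distr M.smult_r_minus)
  then show ?thesis
    using assms M.submoduleE(4)[OF null_submodule]
    by (simp add: tensor_def Let_def) (intro UN_coset coset_eqI; simp)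
qed

lemma tensor_mult:
  assumes x: "x \<in> carrier M" and y: "y \<in> carrier M"
  shows "coset x \<otimes>\<^bsub>Q\<^esub> coset y = coset (x \<otimes>\<^bsub>M\<^esub> y)"
proof -
  have "coset (x' \<otimes>\<^bsub>M\<^esub> y') = coset (x \<otimes>\<^bsub>M\<^esub> y)"
    if x': "x' \<in> carrier M" "x' \<ominus>\<^bsub>M\<^esub> x \<in> N" and y': "y' \<in> carrier M" "y' \<ominus>\<^bsub>M\<^esub> y \<in> N" for x' y'
  proof -
    \<comment> \<open>Change one representative at a time: the differences \<open>(x' - x) y'\<close> and \<open>x (y' - y)\<close> are in
      the ideal.\<close>
    have "coset (x' \<otimes>\<^bsub>M\<^esub> y') = coset (x \<otimes>\<^bsub>M\<^esub> y')"
      using x x' y' null_mult(1)[OF x'(2) y'(1)]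
      by (intro coset_eqI) (simp_all add: M.mult_closed linear_map.minus[OF M.linear_map_mult_left])
    also have "\<dots> = coset (x \<otimes>\<^bsub>M\<^esub> y)"
      using x y y' null_mult(2)[OF y'(2) x]
      by (intro coset_eqI) (simp_all add: M.mult_closed linear_map.minus[OF M.linear_map_mult_right])
    finally show ?thesis .
  qed
  then show ?thesis
    using x y by (simp add: tensor_def Let_def rcoset_mult_def) (intro UN_coset; blast)
qed

lemma tensor_nonassoc_algebra: "nonassoc_algebra K Q"
proof -
  note ops = tensor_add tensor_zero tensor_smult tensor_mult
  have "abelian_group Q"
  proof (rule abelian_groupI)
    fix X assume "X \<in> carrier Q"
    then obtain x where x: "x \<in> carrier M" "X = coset x"
      by (rule tensor_carrierE)
    then show "\<exists>Y\<in>carrier Q. Y \<oplus>\<^bsub>Q\<^esub> X = \<zero>\<^bsub>Q\<^esub>"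
      by (intro bexI[of _ "coset (\<ominus>\<^bsub>M\<^esub> x)"])
        (simp_all add: ops M.l_neg tensor_carrier)
  qed (auto simp: tensor_carrier ops M.a_ac)
  then have "module K Q"
    by (intro moduleI is_cring)
      (auto simp: tensor_carrier ops M.smult_l_distr M.smult_r_distr M.smult_assoc1)
  then show ?thesis
    by (intro nonassoc_algebra.intro nonassoc_algebra_axioms.intro)
      (auto simp: tensor_carrier ops M.mult_closed M.mult_add_left M.mult_add_right
        M.mult_smult_left M.mult_smult_right)
qed

sublocale Q: nonassoc_algebra K Q
  by (rule tensor_nonassoc_algebra)

lemma pure_closed: "\<lbrakk>a \<in> carrier A; b \<in> carrier B\<rbrakk> \<Longrightarrow> a \<otimes>\<otimes> b \<in> carrier Q"
  by (simp add: elem_tensor_def tensor_carrier)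

lemma pure_add_left:
  "\<lbrakk>a \<in> carrier A; a' \<in> carrier A; b \<in> carrier B\<rbrakk>
    \<Longrightarrow> (a \<oplus>\<^bsub>A\<^esub> a') \<otimes>\<otimes> b = a \<otimes>\<otimes> b \<oplus>\<^bsub>Q\<^esub> a' \<otimes>\<otimes> b"
  unfolding elem_tensor_def
  by (simp add: tensor_add) (intro coset_eqI relator_add_left; simp)

lemma pure_smult_left:
  "\<lbrakk>k \<in> carrier K; a \<in> carrier A; b \<in> carrier B\<rbrakk> \<Longrightarrow> (k \<odot>\<^bsub>A\<^esub> a) \<otimes>\<otimes> b = k \<odot>\<^bsub>Q\<^esub> a \<otimes>\<otimes> b"
  unfolding elem_tensor_def
  by (simp add: tensor_smult) (intro coset_eqI relator_smult_left; simp)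

lemma pure_linear_left: "b \<in> carrier B \<Longrightarrow> linear_map K A Q (\<lambda>a. a \<otimes>\<otimes> b)"
  by (intro linear_map.intro linear_map_axioms.intro A.module_axioms Q.module_axioms)
    (simp_all add: pure_closed pure_add_left pure_smult_left)

lemma pure_mult:
  "\<lbrakk>a \<in> carrier A; b \<in> carrier B; a' \<in> carrier A; b' \<in> carrier B\<rbrakk>
    \<Longrightarrow> a \<otimes>\<otimes> b \<otimes>\<^bsub>Q\<^esub> a' \<otimes>\<otimes> b' = (a \<otimes>\<^bsub>A\<^esub> a') \<otimes>\<otimes> (b \<otimes>\<^bsub>B\<^esub> b')"
  by (simp add: elem_tensor_def tensor_mult basis_mult)

text \<open>
  Pure tensors generate \<open>Q\<close> as an additive group, since a scalar can be absorbed into the left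
  factor. Hence neither zero nor scalar multiples need a case of their own.
\<close>

lemma tensor_induct [consumes 1, case_names pure add]:
  assumes "X \<in> carrier Q"
    and pure: "\<And>a b. \<lbrakk>a \<in> carrier A; b \<in> carrier B\<rbrakk> \<Longrightarrow> P (a \<otimes>\<otimes> b)"
    and add: "\<And>X Y. \<lbrakk>X \<in> carrier Q; Y \<in> carrier Q; P X; P Y\<rbrakk> \<Longrightarrow> P (X \<oplus>\<^bsub>Q\<^esub> Y)"
  shows "P X"
proof -
  obtain x where x: "x \<in> carrier M" "X = coset x"
    using assms(1) by (rule tensor_carrierE)
  \<comment> \<open>The scalar moves into the left factor, and \<open>k = \<zero>\<close> gives the zero vector.\<close>
  have smult: "P (coset (k \<odot>\<^bsub>M\<^esub> e a b))"
    if "k \<in> carrier K" "a \<in> carrier A" "b \<in> carrier B" for k a b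
    using pure[of "k \<odot>\<^bsub>A\<^esub> a" b] that pure_smult_left[OF that]
    by (simp add: elem_tensor_def tensor_smult)
  have "P (coset x)"
    using x(1)
  proof (induction x rule: free_induct)
    case zero
    then show ?case
      using smult[of \<zero> "\<zero>\<^bsub>A\<^esub>" "\<zero>\<^bsub>B\<^esub>"] by simp
  next
    case (smult_basis k a b)
    then show ?case
      by (rule smult)
  next
    case (add x y)
    then show ?case
      using assms(3)[of "coset x" "coset y"] by (simp add: tensor_carrier tensor_add)
  qed
  then show ?thesis
    using x by simp
qed

end

lemma (in tensor_pair) alg_hom_eqI:
  assumes t: "t \<in> alg_hom K Q W" and t': "t' \<in> alg_hom K Q W"
    and pure: "\<And>a b. \<lbrakk>a \<in> carrier A; b \<in> carrier B\<rbrakk> \<Longrightarrow> t (a \<otimes>\<otimes> b) = t' (a \<otimes>\<otimes> b)"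
  shows "t = t'"
proof (rule extensionalityI[of t "carrier Q"])
  show "t \<in> extensional (carrier Q)" "t' \<in> extensional (carrier Q)"
    using t t' by (auto simp: alg_hom_def PiE_def)
  fix X assume "X \<in> carrier Q"
  then show "t X = t' X"
  proof (induction X rule: tensor_induct)
    case (pure a b)
    then show ?case
      by (rule assms(3))
  next
    case (add X Y)
    then show ?case
      using t t' by (simp add: alg_hom_def)
  qed
qed

section \<open>The associativity identity on the tensor product\<close>

text \<open>
  Additivity in each of the coordinates indexed by \<open>I\<close>. Arguments are families rather than tuples,
  so that a permutation of the arguments is a composition.
\<close>

definition multiadditive :: "'i set \<Rightarrow> ('a, 'm) ring_scheme \<Rightarrow> (('i \<Rightarrow> 'a) \<Rightarrow> 'a) \<Rightarrow> bool" where
  "multiadditive I G F \<longleftrightarrow> F \<in> (I \<rightarrow> carrier G) \<rightarrow> carrier G \<and>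
    (\<forall>x\<in>I \<rightarrow> carrier G. \<forall>j\<in>I. \<forall>u\<in>carrier G. \<forall>v\<in>carrier G.
      F (x(j := u \<oplus>\<^bsub>G\<^esub> v)) = F (x(j := u)) \<oplus>\<^bsub>G\<^esub> F (x(j := v)))"

lemma (in abelian_group) multiadditive_finsum:
  assumes "\<And>s. s \<in> S \<Longrightarrow> multiadditive I G (F s)"
  shows "multiadditive I G (\<lambda>x. \<Oplus>s\<in>S. F s x)"
proof -
  have closed: "(\<lambda>s. F s x) \<in> S \<rightarrow> carrier G" if "x \<in> I \<rightarrow> carrier G" for x
    using assms that unfolding multiadditive_def by blast
  show ?thesis
    unfolding multiadditive_def
  proof (intro conjI ballI)
    show "(\<lambda>x. \<Oplus>s\<in>S. F s x) \<in> (I \<rightarrow> carrier G) \<rightarrow> carrier G"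
      by (rule Pi_I) (rule finsum_closed[OF closed])
  next
    fix x j u v
    assume x: "x \<in> I \<rightarrow> carrier G" "j \<in> I" "u \<in> carrier G" "v \<in> carrier G"
    then have upd: "x(j := w) \<in> I \<rightarrow> carrier G" if "w \<in> {u, v}" for w
      using that by auto
    have "(\<Oplus>s\<in>S. F s (x(j := u \<oplus> v))) = (\<Oplus>s\<in>S. F s (x(j := u)) \<oplus> F s (x(j := v)))"
      using assms x closed[OF upd[of u]] closed[OF upd[of v]]
      unfolding multiadditive_def by (intro finsum_cong') auto
    also have "\<dots> = (\<Oplus>s\<in>S. F s (x(j := u))) \<oplus> (\<Oplus>s\<in>S. F s (x(j := v)))"
      by (rule finsum_addf) (rule closed[OF upd], simp)+
    finally show "(\<Oplus>s\<in>S. F s (x(j := u \<oplus> v))) = (\<Oplus>s\<in>S. F s (x(j := u))) \<oplus> (\<Oplus>s\<in>S. F s (x(j := v)))" .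
  qed
qed

lemma (in abelian_group) multiadditive_int_multiple:
  assumes "multiadditive I G F"
  shows "multiadditive I G (\<lambda>x. [(n::int)] \<cdot> F x)"
proof -
  have "F (x(j := u)) \<in> carrier G" if "x \<in> I \<rightarrow> carrier G" "u \<in> carrier G" for x j u
    using assms that unfolding multiadditive_def by (auto simp: Pi_iff)
  then show ?thesis
    using assms unfolding multiadditive_def
    by (auto simp: add.int_pow_distrib Pi_iff)
qed

context
  fixes K :: "('k, 'm) ring_scheme" and A :: "('k, 'a) module" (structure)
  assumes A: "nonassoc_algebra K A"
begin

interpretation nonassoc_algebra K A
  by (rule A)

lemma associator_closed:
  "\<lbrakk>x \<in> carrier A; y \<in> carrier A; z \<in> carrier A\<rbrakk> \<Longrightarrow> associator A x y z \<in> carrier A"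
  by (simp add: associator_def mult_closed)

lemma associator_add:
  assumes "u \<in> carrier A" "v \<in> carrier A" "y \<in> carrier A" "z \<in> carrier A"
  shows "associator A (u \<oplus> v) y z = associator A u y z \<oplus> associator A v y z"
    and "associator A y (u \<oplus> v) z = associator A y u z \<oplus> associator A y v z"
    and "associator A y z (u \<oplus> v) = associator A y z u \<oplus> associator A y z v"
  using assms
  by (simp_all add: associator_def mult_closed mult_add_left mult_add_right a_minus_def
      M.minus_add M.a_ac)

text \<open>
  Permuting the arguments only changes the slot of the associator in which the \<open>j\<close>-th coordinate is
  inserted, and injectivity of \<open>p\<close> ensures that there is just one such slot.
\<close>

lemma multiadditive_associator:
  assumes p: "p permutes {1, 2, 3::nat}"
  shows "multiadditive {1, 2, 3} A (\<lambda>x. associator A (x (p 1)) (x (p 2)) (x (p 3)))"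
  unfolding multiadditive_def
proof (intro conjI ballI Pi_I)
  have p123: "p 1 \<in> {1, 2, 3}" "p 2 \<in> {1, 2, 3}" "p 3 \<in> {1, 2, 3}"
    by (subst permutes_in_image[OF p]; simp)+
  {
    fix x :: "nat \<Rightarrow> 'a" assume "x \<in> {1, 2, 3} \<rightarrow> carrier A"
    then have *: "x (p 1) \<in> carrier A" "x (p 2) \<in> carrier A" "x (p 3) \<in> carrier A"
      using p123 by blast+
    then show "associator A (x (p 1)) (x (p 2)) (x (p 3)) \<in> carrier A"
      by (rule associator_closed)
    note *
  } note closed = this
  fix x :: "nat \<Rightarrow> 'a" and j :: nat and u v :: 'a
  assume x: "x \<in> {1, 2, 3} \<rightarrow> carrier A" and j: "j \<in> {1, 2, 3}"
    and uv: "u \<in> carrier A" "v \<in> carrier A"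
  have upd: "(x(p m := w)) (p l) = (if l = m then w else x (p l))" for m l w
    using permutes_inj[OF p] by (auto simp: inj_eq)
  obtain m where "m \<in> {1, 2, 3}" "j = p m"
    using j permutes_image[OF p] by (metis imageE)
  then show "associator A ((x(j := u \<oplus> v)) (p 1)) ((x(j := u \<oplus> v)) (p 2)) ((x(j := u \<oplus> v)) (p 3))
      = associator A ((x(j := u)) (p 1)) ((x(j := u)) (p 2)) ((x(j := u)) (p 3))
        \<oplus> associator A ((x(j := v)) (p 1)) ((x(j := v)) (p 2)) ((x(j := v)) (p 3))"
    using closed[OF x] uv by (auto simp only: upd) (auto simp: associator_add)
qed

end

text \<open>
  The coordinates are made arbitrary one at a time: \<open>J\<close> is the set of coordinates that range over all of
  \<open>Q\<close>, while the others are still pure tensors. The hypothesis on pure tensors constrains \<open>x\<close> on \<open>I\<close>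
  only, because \<open>F\<close> may also depend on the values of the family outside \<open>I\<close>.
\<close>

lemma (in tensor_pair) multiadditive_zero_on_pure:
  assumes I: "finite I" and F: "multiadditive I Q F"
    and pure: "\<And>x a b. \<lbrakk>a \<in> I \<rightarrow> carrier A; b \<in> I \<rightarrow> carrier B;
        \<And>j. j \<in> I \<Longrightarrow> x j = a j \<otimes>\<otimes> b j\<rbrakk> \<Longrightarrow> F x = \<zero>\<^bsub>Q\<^esub>"
    and x: "x \<in> I \<rightarrow> carrier Q"
  shows "F x = \<zero>\<^bsub>Q\<^esub>"
proof -
  let ?pure = "{X. \<exists>a\<in>carrier A. \<exists>b\<in>carrier B. X = a \<otimes>\<otimes> b}"
  have pure_carrier: "?pure \<subseteq> carrier Q"
    using pure_closed by auto
  have "F x = \<zero>\<^bsub>Q\<^esub>" if "J \<subseteq> I" "x \<in> I \<rightarrow> carrier Q" "x \<in> I - J \<rightarrow> ?pure" for J x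
    using finite_subset[OF that(1) I] that
  proof (induction J arbitrary: x rule: finite_induct)
    case empty
    then have "\<forall>j\<in>I. \<exists>a b. a \<in> carrier A \<and> b \<in> carrier B \<and> x j = a \<otimes>\<otimes> b"
      by blast
    then obtain a b where
      "\<forall>j\<in>I. a j \<in> carrier A \<and> b j \<in> carrier B \<and> x j = a j \<otimes>\<otimes> b j"
      by metis
    then show ?case
      by (intro pure[of a b]) auto
  next
    case (insert j J)
    have "F (x(j := X)) = \<zero>\<^bsub>Q\<^esub>" if "X \<in> carrier Q" for X
      using that
    proof (induction X rule: tensor_induct)
      case (pure a b)
      have "x(j := a \<otimes>\<otimes> b) \<in> I \<rightarrow> carrier Q" "x(j := a \<otimes>\<otimes> b) \<in> I - J \<rightarrow> ?pure"
        using insert.prems pure pure_closed by (auto simp: Pi_iff)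
      then show ?case
        using insert.IH insert.prems(1) by blast
    next
      case (add X Y)
      have "F (x(j := X \<oplus>\<^bsub>Q\<^esub> Y)) = F (x(j := X)) \<oplus>\<^bsub>Q\<^esub> F (x(j := Y))"
        using F insert.prems add.hyps unfolding multiadditive_def by blast
      also have "\<dots> = \<zero>\<^bsub>Q\<^esub>"
        unfolding add.IH by simp
      finally show ?case .
    qed
    from this[of "x j"] show ?case
      using insert.prems by auto
  qed
  from this[of I x] show ?thesis
    using x by simp
qed

text \<open>
  Here \<open>j\<close> is the image of 1, and \<open>k\<close> is the image of 2 after 1 has been moved back to its place. The
  parity can be read off: each factor is odd unless it is trivial.
\<close>

lemma permutes_123_cases:
  assumes "p permutes {1, 2, 3::nat}"
  obtains j k where "j \<in> {1, 2, 3}" "k \<in> {2, 3}" "p = transpose 1 j \<circ> transpose 2 k"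
proof -
  have "p \<in> {p. p permutes insert 1 (insert 2 {3::nat})}"
    using assms by simp
  then obtain j q where j: "j \<in> {1, 2, 3}" "p = transpose 1 j \<circ> q" and "q permutes insert 2 {3}"
    unfolding permutes_insert[of 1] by (auto simp del: insert_iff)
  then have "q \<in> {q. q permutes insert 2 {3}}"
    by simp
  then have "q = transpose 2 2 \<or> q = transpose 2 3"
    unfolding permutes_insert[of 2] permutes_sing by auto
  then obtain k where "k \<in> {2, 3}" "q = transpose 2 k"
    by blast
  then show thesis
    using that j by simp
qed

lemma Gsub_permutes:
  assumes "\<sigma> \<in> Gsub i"
  shows "\<sigma> permutes {1, 2, 3}"
proof -
  have *: "{Suc 0..3} = {Suc 0, 2, 3::nat}"
    by auto
  show ?thesis
    using assms
    by (auto simp: Gsub_def sym_group_carrier alt_group_carrier * permutes_id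
        intro: permutes_swap_id split: if_splits)
qed

text \<open>
  This is where the dual identities enter. For \<open>i = 2, 3, 4\<close> the identity is the invariance
  under the only non-trivial element. The two equations for \<open>i = 5\<close> are the two rotations, and an even permutation
  is a rotation. For \<open>i = 6\<close> the identity gives two adjacent transpositions, which generate
  \<open>\<Sigma>\<^sub>3\<close>.
\<close>

lemma (in dual_G_assoc_algebra) product_Gsub_invariant:
  assumes i: "i \<in> {1..6}" and \<sigma>: "\<sigma> \<in> Gsub i" and b: "b \<in> {1, 2, 3} \<rightarrow> carrier B"
  shows "b (inv_into UNIV \<sigma> 1) \<otimes> b (inv_into UNIV \<sigma> 2) \<otimes> b (inv_into UNIV \<sigma> 3)
    = b 1 \<otimes> b 2 \<otimes> b 3"
proof -
  let ?p = "inv_into UNIV \<sigma>"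
  note perm = permutes_inv[OF Gsub_permutes[OF \<sigma>]]
  have b123: "b 1 \<in> carrier B" "b 2 \<in> carrier B" "b 3 \<in> carrier B"
    using b by auto
  consider "i = 1" | "i = 2" | "i = 3" | "i = 4" | "i = 5" | "i = 6"
    using i by force
  then show ?thesis
  proof cases
    case 5
    then have even: "evenperm ?p"
      using \<sigma> evenperm_inv alt_group_carrier' alt_group_carrier by (auto simp: Gsub_def)
    obtain j k where jk: "j \<in> {1, 2, 3}" "k \<in> {2, 3}" "?p = transpose 1 j \<circ> transpose 2 k"
      using permutes_123_cases[OF perm] .
    have parity: "(j = 1) = (k = 2)"
      using even unfolding jk(3)
      by (simp add: evenperm_comp permutation_swap_id evenperm_swap eq_commute)
    have
        "b 2 \<otimes> b 3 \<otimes> b 1 = b 1 \<otimes> b 2 \<otimes> b 3"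
        "b 3 \<otimes> b 1 \<otimes> b 2 = b 1 \<otimes> b 2 \<otimes> b 3"
      using dual5[OF 5 b123] by presburger+
    moreover have "(?p 1, ?p 2, ?p 3) \<in> {(1, 2, 3), (2, 3, 1), (3, 1, 2)}"
      using jk(1,2) parity unfolding jk(3) by (elim insertE emptyE) (simp_all add: transpose_def)
    ultimately show ?thesis
      by auto
  next
    case 6
    obtain j k where jk: "j \<in> {1, 2, 3}" "k \<in> {2, 3}" "?p = transpose 1 j \<circ> transpose 2 k"
      using permutes_123_cases[OF perm] .
    have
        "b 1 \<otimes> b 3 \<otimes> b 2 = b 1 \<otimes> b 2 \<otimes> b 3" "b 2 \<otimes> b 1 \<otimes> b 3 = b 1 \<otimes> b 2 \<otimes> b 3"
        "b 2 \<otimes> b 3 \<otimes> b 1 = b 1 \<otimes> b 2 \<otimes> b 3" "b 3 \<otimes> b 1 \<otimes> b 2 = b 1 \<otimes> b 2 \<otimes> b 3"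
        "b 3 \<otimes> b 2 \<otimes> b 1 = b 1 \<otimes> b 2 \<otimes> b 3"
      using b123 dual6[OF 6, of "b 1" "b 2" "b 3"] dual6[OF 6, of "b 2" "b 3" "b 1"]
        dual6[OF 6, of "b 3" "b 1" "b 2"] by metis+
    moreover have "(?p 1, ?p 2, ?p 3) \<in>
        {(1, 2, 3), (1, 3, 2), (2, 1, 3), (2, 3, 1), (3, 1, 2), (3, 2, 1)}"
      using jk(1,2) unfolding jk(3) by (elim insertE emptyE) (simp_all add: transpose_def)
    ultimately show ?thesis
      by auto
  next
    case 2
    have "b 2 \<otimes> b 1 \<otimes> b 3 = b 1 \<otimes> b 2 \<otimes> b 3"
      using b123 by (intro dual2 2)
    then show ?thesis
      using \<sigma> 2 by (auto simp: Gsub_def inv_id transpose_def)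
  next
    case 3
    have "b 1 \<otimes> b 3 \<otimes> b 2 = b 1 \<otimes> b 2 \<otimes> b 3"
      using b123 by (intro dual3 3)
    then show ?thesis
      using \<sigma> 3 by (auto simp: Gsub_def inv_id transpose_def)
  next
    case 4
    have "b 3 \<otimes> b 2 \<otimes> b 1 = b 1 \<otimes> b 2 \<otimes> b 3"
      using b123 by (intro dual4 4)
    then show ?thesis
      using \<sigma> 4 by (auto simp: Gsub_def inv_id transpose_def)
  qed (use \<sigma> in \<open>simp add: Gsub_def inv_id\<close>)
qed

text \<open>
  The product \<open>\<beta>\<close> of the right factors is the same for every \<open>\<sigma>\<close>, so that the alternating sum of
  associators in \<open>Q\<close> is the image of the one in \<open>A\<close> under the linear map \<open>a \<mapsto> a \<otimes> \<beta>\<close>.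
\<close>

lemma (in tensor_pair) tensor_G_assoc_algebra:
  assumes i: "i \<in> {1..6}" and A: "G_assoc_algebra i K A" and B: "dual_G_assoc_algebra i K B"
  shows "G_assoc_algebra i K Q"
proof (intro G_assoc_algebra.intro G_assoc_algebra_axioms.intro tensor_nonassoc_algebra)
  let ?I = "{1, 2, 3 :: nat}"
  let ?F = "\<lambda>\<sigma> x. [sign \<sigma>] \<cdot>\<^bsub>Q\<^esub> associator Q (x (inv_into UNIV \<sigma> 1)) (x (inv_into UNIV \<sigma> 2))
    (x (inv_into UNIV \<sigma> 3))"
  fix x assume x: "x \<in> ?I \<rightarrow> carrier Q"
  have multi: "multiadditive ?I Q (\<lambda>x. \<Oplus>\<^bsub>Q\<^esub>\<sigma>\<in>Gsub i. ?F \<sigma> x)"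
    by (intro Q.multiadditive_finsum Q.multiadditive_int_multiple permutes_inv Gsub_permutes
        multiadditive_associator[OF tensor_nonassoc_algebra])
  have on_pure: "(\<Oplus>\<^bsub>Q\<^esub>\<sigma>\<in>Gsub i. ?F \<sigma> x) = \<zero>\<^bsub>Q\<^esub>"
    if a: "a \<in> ?I \<rightarrow> carrier A" and b: "b \<in> ?I \<rightarrow> carrier B"
      and x: "\<And>j. j \<in> ?I \<Longrightarrow> x j = a j \<otimes>\<otimes> b j" for x a b
  proof -
    let ?f = "\<lambda>\<sigma>. [sign \<sigma>] \<cdot>\<^bsub>A\<^esub> associator A (a (inv_into UNIV \<sigma> 1)) (a (inv_into UNIV \<sigma> 2))
      (a (inv_into UNIV \<sigma> 3))"
    define \<beta> where "\<beta> = b 1 \<otimes>\<^bsub>B\<^esub> b 2 \<otimes>\<^bsub>B\<^esub> b 3"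
    have \<beta>: "\<beta> \<in> carrier B"
      using b by (auto simp: \<beta>_def B.mult_closed)
    interpret \<phi>: linear_map K A Q "\<lambda>a. a \<otimes>\<otimes> \<beta>"
      by (rule pure_linear_left[OF \<beta>])
    have summand: "?F \<sigma> x = ?f \<sigma> \<otimes>\<otimes> \<beta> \<and> ?f \<sigma> \<in> carrier A" if \<sigma>: "\<sigma> \<in> Gsub i" for \<sigma>
    proof -
      let ?p = "inv_into UNIV \<sigma>"
      have p: "?p 1 \<in> ?I" "?p 2 \<in> ?I" "?p 3 \<in> ?I"
        by (subst permutes_in_image[OF permutes_inv[OF Gsub_permutes[OF \<sigma>]]]; simp)+
      have ab: "a (?p 1) \<in> carrier A" "a (?p 2) \<in> carrier A" "a (?p 3) \<in> carrier A"
        "b (?p 1) \<in> carrier B" "b (?p 2) \<in> carrier B" "b (?p 3) \<in> carrier B"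
        using a b p by blast+
      have \<beta>p: "b (?p 1) \<otimes>\<^bsub>B\<^esub> b (?p 2) \<otimes>\<^bsub>B\<^esub> b (?p 3) = \<beta>"
        unfolding \<beta>_def by (rule dual_G_assoc_algebra.product_Gsub_invariant[OF B i \<sigma> b])
      \<comment> \<open>The two terms of the associator bracket the right factors differently.\<close>
      have "b (?p 1) \<otimes>\<^bsub>B\<^esub> (b (?p 2) \<otimes>\<^bsub>B\<^esub> b (?p 3)) = \<beta>"
        using dual_G_assoc_algebra.assoc[OF B ab(4-6)] \<beta>p by simp
      with \<beta>p have "associator Q (x (?p 1)) (x (?p 2)) (x (?p 3))
          = associator A (a (?p 1)) (a (?p 2)) (a (?p 3)) \<otimes>\<otimes> \<beta>"
        using ab unfolding x[OF p(1)] x[OF p(2)] x[OF p(3)] associator_def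
        by (simp add: pure_mult A.mult_closed B.mult_closed \<phi>.minus)
      then show ?thesis
        using associator_closed[OF A.nonassoc_algebra_axioms ab(1-3)]
        by (simp add: \<phi>.int_multiple)
    qed
    have "(\<Oplus>\<^bsub>Q\<^esub>\<sigma>\<in>Gsub i. ?F \<sigma> x) = (\<Oplus>\<^bsub>Q\<^esub>\<sigma>\<in>Gsub i. ?f \<sigma> \<otimes>\<otimes> \<beta>)"
      using summand \<phi>.closed by (intro Q.finsum_cong') auto
    also have "\<dots> = (\<Oplus>\<^bsub>A\<^esub>\<sigma>\<in>Gsub i. ?f \<sigma>) \<otimes>\<otimes> \<beta>"
      using summand by (intro \<phi>.finsum[symmetric]) auto
    also have "\<dots> = \<zero>\<^bsub>Q\<^esub>"
      unfolding G_assoc_algebra.G_assoc[OF A a] by (rule \<phi>.zero)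
    finally show ?thesis .
  qed
  show "(\<Oplus>\<^bsub>Q\<^esub>\<sigma>\<in>Gsub i. ?F \<sigma> x) = \<zero>\<^bsub>Q\<^esub>"
    by (rule multiadditive_zero_on_pure[OF _ multi on_pure x]) simp_all
qed

section \<open>Tensor products of homomorphisms\<close>

locale tensor_pair_hom = S: tensor_pair K A B + T: tensor_pair K A' B'
  for K :: "('k, 'm) ring_scheme" (structure)
    and A :: "('k, 'a) module" and B :: "('k, 'b) module"
    and A' :: "('k, 'c) module" and B' :: "('k, 'd) module" +
  fixes g :: "'a \<Rightarrow> 'c" and f :: "'b \<Rightarrow> 'd"
  assumes g: "g \<in> alg_hom K A A'" and f: "f \<in> alg_hom K B B'"
begin

abbreviation \<phi> where "\<phi> \<equiv> free_map K (map_prod g f)"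
abbreviation t where "t \<equiv> tensor_map K A B A' B' g f"

lemma g_hom:
  "x \<in> carrier A \<Longrightarrow> g x \<in> carrier A'"
  "\<lbrakk>x \<in> carrier A; y \<in> carrier A\<rbrakk> \<Longrightarrow> g (x \<oplus>\<^bsub>A\<^esub> y) = g x \<oplus>\<^bsub>A'\<^esub> g y"
  "\<lbrakk>k \<in> carrier K; x \<in> carrier A\<rbrakk> \<Longrightarrow> g (k \<odot>\<^bsub>A\<^esub> x) = k \<odot>\<^bsub>A'\<^esub> g x"
  "\<lbrakk>x \<in> carrier A; y \<in> carrier A\<rbrakk> \<Longrightarrow> g (x \<otimes>\<^bsub>A\<^esub> y) = g x \<otimes>\<^bsub>A'\<^esub> g y"
  using g by (auto simp: alg_hom_def)

lemma f_hom:
  "x \<in> carrier B \<Longrightarrow> f x \<in> carrier B'"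
  "\<lbrakk>x \<in> carrier B; y \<in> carrier B\<rbrakk> \<Longrightarrow> f (x \<oplus>\<^bsub>B\<^esub> y) = f x \<oplus>\<^bsub>B'\<^esub> f y"
  "\<lbrakk>k \<in> carrier K; x \<in> carrier B\<rbrakk> \<Longrightarrow> f (k \<odot>\<^bsub>B\<^esub> x) = k \<odot>\<^bsub>B'\<^esub> f x"
  "\<lbrakk>x \<in> carrier B; y \<in> carrier B\<rbrakk> \<Longrightarrow> f (x \<otimes>\<^bsub>B\<^esub> y) = f x \<otimes>\<^bsub>B'\<^esub> f y"
  using f by (auto simp: alg_hom_def)

text \<open>
  As for the product, summing over a fixed finite set that contains the support makes
  \<open>\<phi>\<close> visibly linear.
\<close>

lemma free_map_on:
  assumes "x \<in> carrier S.M" "finite R" "S.supp x \<subseteq> R"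
  shows "\<phi> x q = finsum K (\<lambda>p. if map_prod g f p = q then x p else \<zero>) R"
  unfolding free_map_def
  by (rule S.add.finprod_mono_neutral_cong_left)
    (use assms S.free_coeff[OF assms(1)] in \<open>auto simp: S.supp_def split: if_splits\<close>)

lemma free_map_closed:
  assumes x: "x \<in> carrier S.M"
  shows "\<phi> x \<in> carrier T.M"
proof -
  note coeff = S.free_coeff[OF x] and fin = S.free_finite_supp[OF x]
  note on = free_map_on[OF x fin order_refl]
  have "T.supp (\<phi> x) \<subseteq> map_prod g f ` S.supp x"
  proof
    fix q assume "q \<in> T.supp (\<phi> x)"
    moreover have "\<phi> x q = \<zero>" if "q \<notin> map_prod g f ` S.supp x"
      unfolding on using that by (intro S.add.finprod_one_eqI) auto
    ultimately show "q \<in> map_prod g f ` S.supp x"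
      by (auto simp: T.supp_def)
  qed
  moreover have "map_prod g f ` S.supp x \<subseteq> carrier A' \<times> carrier B'"
    using S.free_supp[OF x] by (fastforce simp: g_hom f_hom)
  moreover have "\<phi> x q \<in> carrier K" for q
    unfolding on using coeff by (intro S.finsum_closed) auto
  ultimately show ?thesis
    unfolding T.free_carrier using fin
    by (meson finite_imageI finite_subset subset_trans)
qed

lemma free_map_linear: "linear_map K S.M T.M \<phi>"
proof (intro linear_map.intro linear_map_axioms.intro S.free_module T.free_module free_map_closed)
  fix x assume x: "x \<in> carrier S.M"
  note coeff = S.free_coeff[OF x] and fin = S.free_finite_supp[OF x]
  {
    fix k assume k: "k \<in> carrier K"
    show "\<phi> (k \<odot>\<^bsub>S.M\<^esub> x) = k \<odot>\<^bsub>T.M\<^esub> \<phi> x"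
    proof
      fix q
      have "\<phi> (k \<odot>\<^bsub>S.M\<^esub> x) q =
          finsum K (\<lambda>p. if map_prod g f p = q then (k \<odot>\<^bsub>S.M\<^esub> x) p else \<zero>) (S.supp x)"
        by (intro free_map_on S.free_smult_closed S.supp_smult k x fin)
      also have "\<dots> = finsum K (\<lambda>p. k \<otimes> (if map_prod g f p = q then x p else \<zero>)) (S.supp x)"
        using k coeff by (intro S.finsum_cong') (auto simp: S.free_smult)
      also have "\<dots> = k \<otimes> \<phi> x q"
        unfolding free_map_on[OF x fin order_refl]
        by (rule S.finsum_rdistr[symmetric]) (use k coeff fin in auto)
      finally show "\<phi> (k \<odot>\<^bsub>S.M\<^esub> x) q = (k \<odot>\<^bsub>T.M\<^esub> \<phi> x) q"
        by (simp add: T.free_smult)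
    qed
  }
  fix y assume y: "y \<in> carrier S.M"
  note coeff' = S.free_coeff[OF y] and fin' = S.free_finite_supp[OF y]
  show "\<phi> (x \<oplus>\<^bsub>S.M\<^esub> y) = \<phi> x \<oplus>\<^bsub>T.M\<^esub> \<phi> y"
  proof
    fix q
    let ?R = "S.supp x \<union> S.supp y"
    let ?s = "\<lambda>z p. if map_prod g f p = q then z p else \<zero>"
    have on: "\<phi> z q = finsum K (?s z) ?R" if "z \<in> {x, y, x \<oplus>\<^bsub>S.M\<^esub> y}" for z
      using that x y fin fin' S.supp_add[of x y] by (intro free_map_on) auto
    have "?s (x \<oplus>\<^bsub>S.M\<^esub> y) = (\<lambda>p. ?s x p \<oplus> ?s y p)"
      using coeff coeff' by (auto simp: fun_eq_iff S.free_add)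
    then have "\<phi> (x \<oplus>\<^bsub>S.M\<^esub> y) q = \<phi> x q \<oplus> \<phi> y q"
      using coeff coeff' by (simp add: on)
    then show "\<phi> (x \<oplus>\<^bsub>S.M\<^esub> y) q = (\<phi> x \<oplus>\<^bsub>T.M\<^esub> \<phi> y) q"
      by (simp add: T.free_add)
  qed
qed

sublocale \<phi>: linear_map K S.M T.M \<phi>
  by (rule free_map_linear)

lemma free_map_basis:
  assumes "a \<in> carrier A" "b \<in> carrier B"
  shows "\<phi> (S.e a b) = T.e (g a) (f b)"
proof
  fix q
  show "\<phi> (S.e a b) q = T.e (g a) (f b) q"
    using assms
    by (subst free_map_on[of _ "{(a, b)}"]) (simp_all add: S.supp_basis, auto simp: basis_vec_def)
qed

lemma free_map_null:
  assumes "x \<in> S.N"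
  shows "\<phi> x \<in> T.N"
  by (rule S.linear_map_null[OF free_map_linear T.null_submodule assms])
    (simp_all add: free_map_basis g_hom f_hom T.relator_add_left T.relator_add_right
      T.relator_smult_left T.relator_smult_right)

lemma tensor_map_coset:
  assumes x: "x \<in> carrier S.M"
  shows "t (S.coset x) = T.coset (\<phi> x)"
proof -
  have "T.coset (\<phi> y) = T.coset (\<phi> x)" if "y \<in> carrier S.M" "y \<ominus>\<^bsub>S.M\<^esub> x \<in> S.N" for y
    using that x free_map_null[OF that(2)] by (intro T.coset_eqI) (simp_all add: \<phi>.closed \<phi>.minus)
  then have "(\<Union>y\<in>S.coset x. T.coset (\<phi> y)) = T.coset (\<phi> x)"
    by (rule S.UN_coset[OF x])
  then show ?thesis
    using x by (simp add: tensor_map_def S.tensor_carrier)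
qed

lemma tensor_map_pure:
  "\<lbrakk>a \<in> carrier A; b \<in> carrier B\<rbrakk>
    \<Longrightarrow> t (elem_tensor K A B a b) = elem_tensor K A' B' (g a) (f b)"
  by (simp add: elem_tensor_def tensor_map_coset free_map_basis)

lemma tensor_map_linear: "linear_map K S.Q T.Q t"
  by (intro linear_map.intro linear_map_axioms.intro S.Q.module_axioms T.Q.module_axioms)
    (auto simp: S.tensor_carrier T.tensor_carrier tensor_map_coset S.tensor_add T.tensor_add
      S.tensor_smult T.tensor_smult \<phi>.closed \<phi>.add \<phi>.smult)

sublocale t: linear_map K S.Q T.Q t
  by (rule tensor_map_linear)

text \<open>
  Both sides are additive in \<open>X\<close> and in \<open>Y\<close>, so it suffices to compare them on pure tensors.
\<close>

lemma tensor_map_mult: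
  assumes X: "X \<in> carrier S.Q" and Y: "Y \<in> carrier S.Q"
  shows "t (X \<otimes>\<^bsub>S.Q\<^esub> Y) = t X \<otimes>\<^bsub>T.Q\<^esub> t Y"
proof -
  have left_pure: "t (elem_tensor K A B a b \<otimes>\<^bsub>S.Q\<^esub> Y) = t (elem_tensor K A B a b) \<otimes>\<^bsub>T.Q\<^esub> t Y"
    if ab: "a \<in> carrier A" "b \<in> carrier B" for a b
    using Y
  proof (induction Y rule: S.tensor_induct)
    case (pure c d)
    then show ?case
      using ab by (simp add: S.pure_mult T.pure_mult tensor_map_pure S.A.mult_closed S.B.mult_closed
          g_hom f_hom)
  next
    case (add Y Z)
    then show ?case
      using ab by (simp add: S.Q.mult_add_right T.Q.mult_add_right S.Q.mult_closed S.pure_closed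
          t.closed t.add)
  qed
  from X show ?thesis
  proof (induction X rule: S.tensor_induct)
    case (pure a b)
    then show ?case
      by (rule left_pure)
  next
    case (add X Z)
    then show ?case
      using Y by (simp add: S.Q.mult_add_left T.Q.mult_add_left S.Q.mult_closed t.closed t.add)
  qed
qed

lemma tensor_map_alg_hom: "t \<in> alg_hom K S.Q T.Q"
  by (simp add: alg_hom_def PiE_def Pi_iff t.closed t.add t.smult tensor_map_mult)
    (simp add: tensor_map_def)

end

section \<open>Categories of algebras and the functor\<close>

lemma alg_id_hom: "nonassoc_algebra K A \<Longrightarrow> alg_id A \<in> alg_hom K A A"
proof -
  assume "nonassoc_algebra K A"
  then interpret nonassoc_algebra K A .
  show ?thesis
    by (auto simp: alg_hom_def alg_id_def mult_closed)
qed

lemma alg_hom_compose: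
  assumes "nonassoc_algebra K A" and f: "f \<in> alg_hom K A B" and g: "g \<in> alg_hom K B C"
  shows "compose (carrier A) g f \<in> alg_hom K A C"
proof -
  interpret nonassoc_algebra K A by fact
  have "f x \<in> carrier B" if "x \<in> carrier A" for x
    using f that by (auto simp: alg_hom_def)
  with f g show ?thesis
    by (auto simp: alg_hom_def compose_def mult_closed)
qed

lemma alg_cat_category:
  assumes S: "\<And>A. A \<in> S \<Longrightarrow> nonassoc_algebra K A"
  shows "category (alg_cat K S)"
proof
  show "Comp (alg_cat K S) X Y Y (Ident (alg_cat K S) Y) f = f"
    if "f \<in> Hom (alg_cat K S) X Y" for X Y f
    using that by (auto simp: alg_cat_def alg_id_def alg_hom_def PiE_def intro: Id_compose)
  show "Comp (alg_cat K S) X X Y f (Ident (alg_cat K S) X) = f"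
    if "f \<in> Hom (alg_cat K S) X Y" for X Y f
    using that by (auto simp: alg_cat_def alg_id_def alg_hom_def PiE_def intro: compose_Id)
  show "Comp (alg_cat K S) W X Z (Comp (alg_cat K S) X Y Z h g) f
      = Comp (alg_cat K S) W Y Z h (Comp (alg_cat K S) W X Y g f)"
    if "f \<in> Hom (alg_cat K S) W X" for W X Y Z f g h
    using that by (auto simp: alg_cat_def alg_hom_def intro!: compose_assoc[symmetric])
qed (use S in \<open>auto simp: alg_cat_def alg_id_hom intro: alg_hom_compose\<close>)

theorem theorem3p1:
  fixes K :: "('k, 'm) ring_scheme"
    and A :: "('k, 'a) module"
    and i :: nat
  assumes "char_zero_field K"
    and "i \<in> {1..6}"
    and "G_assoc_algebra i K A"
  shows "covariant_functor
      (G_ASS_dual i K :: (('k, 'b) module, 'b \<Rightarrow> 'b) cat)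
      (G_ASS i K)
      (\<lambda>B. tensor K A B)
      (\<lambda>B B' f. tensor_map K A B A B' (alg_id A) f) \<and>
    (\<forall>B \<in> Obj (G_ASS_dual i K :: (('k, 'b) module, 'b \<Rightarrow> 'b) cat).
      \<forall>a\<^sub>1\<in>carrier A. \<forall>a\<^sub>2\<in>carrier A. \<forall>b\<^sub>1\<in>carrier B. \<forall>b\<^sub>2\<in>carrier B.
        elem_tensor K A B a\<^sub>1 b\<^sub>1 \<otimes>\<^bsub>tensor K A B\<^esub> elem_tensor K A B a\<^sub>2 b\<^sub>2
          = elem_tensor K A B (a\<^sub>1 \<otimes>\<^bsub>A\<^esub> a\<^sub>2) (b\<^sub>1 \<otimes>\<^bsub>B\<^esub> b\<^sub>2)) \<and>
    (\<forall>B \<in> Obj (G_ASS_dual i K :: (('k, 'b) module, 'b \<Rightarrow> 'b) cat).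
      \<forall>B' \<in> Obj (G_ASS_dual i K). \<forall>f \<in> Hom (G_ASS_dual i K) B B'.
        \<forall>a\<in>carrier A. \<forall>b\<in>carrier B.
          tensor_map K A B A B' (alg_id A) f (elem_tensor K A B a b)
            = elem_tensor K A B' a (f b))"
proof -
  let ?C = "G_ASS_dual i K :: (('k, 'b) module, 'b \<Rightarrow> 'b) cat"
  let ?D = "G_ASS i K :: (('k, ('a \<times> 'b \<Rightarrow> 'k) set) module, _) cat"
  let ?t = "\<lambda>B B' f. tensor_map K A B A B' (alg_id A) f"
  have field: "field K"
    using assms(1) by (rule char_zero_field.axioms)
  have A: "nonassoc_algebra K A"
    using assms(3) by (rule G_assoc_algebra.axioms)
  have C_obj: "B \<in> Obj ?C \<longleftrightarrow> dual_G_assoc_algebra i K B" for B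
    by (simp add: G_ASS_dual_def alg_cat_def)
  have D_obj: "X \<in> Obj ?D \<longleftrightarrow> G_assoc_algebra i K X" for X
    by (simp add: G_ASS_def alg_cat_def)
  have C_hom: "Hom ?C = alg_hom K" "Ident ?C = alg_id"
      "Comp ?C X Y Z g f = compose (carrier X) g f" for X Y Z g f
    by (simp_all add: G_ASS_dual_def alg_cat_def)
  have D_hom: "Hom ?D = alg_hom K" "Ident ?D = alg_id"
      "Comp ?D U V W q p = compose (carrier U) q p" for U V W q p
    by (simp_all add: G_ASS_def alg_cat_def)
  have B: "nonassoc_algebra K B" if "B \<in> Obj ?C" for B
    using that unfolding C_obj by (rule dual_G_assoc_algebra.axioms)
  have pair: "tensor_pair K A B" if "B \<in> Obj ?C" for B
    by (intro tensor_pair.intro field A B that)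
  have hom: "tensor_pair_hom K A B A B' (alg_id A) f"
    if "B \<in> Obj ?C" "B' \<in> Obj ?C" "f \<in> alg_hom K B B'" for B B' f
    by (intro tensor_pair_hom.intro tensor_pair_hom_axioms.intro pair alg_id_hom A that)
  have map_pure: "?t B B' f (elem_tensor K A B a b) = elem_tensor K A B' a (f b)"
    if "B \<in> Obj ?C" "B' \<in> Obj ?C" "f \<in> alg_hom K B B'" "a \<in> carrier A" "b \<in> carrier B"
    for B B' f a b
    using tensor_pair_hom.tensor_map_pure[OF hom[OF that(1-3)] that(4,5)] that(4)
    by (simp add: alg_id_def)
  have map_hom: "?t B B' f \<in> alg_hom K (tensor K A B) (tensor K A B')"
    if "B \<in> Obj ?C" "B' \<in> Obj ?C" "f \<in> alg_hom K B B'" for B B' f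
    by (rule tensor_pair_hom.tensor_map_alg_hom[OF hom[OF that]])
  have "covariant_functor ?C ?D (\<lambda>B. tensor K A B) ?t"
  proof (intro covariant_functor.intro covariant_functor_axioms.intro)
    show "category ?C"
      unfolding G_ASS_dual_def by (rule alg_cat_category) (auto dest: dual_G_assoc_algebra.axioms)
    show "category ?D"
      unfolding G_ASS_def by (rule alg_cat_category) (auto dest: G_assoc_algebra.axioms)
    fix X assume X: "X \<in> Obj ?C"
    interpret X: tensor_pair K A X
      by (rule pair[OF X])
    show "tensor K A X \<in> Obj ?D"
      using X X.tensor_G_assoc_algebra[OF assms(2,3)] by (simp add: C_obj D_obj)
    have idX: "alg_id X \<in> alg_hom K X X"
      by (rule alg_id_hom[OF B[OF X]])
    show "?t X X (Ident ?C X) = Ident ?D (tensor K A X)"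
      unfolding C_hom D_hom
    proof (rule X.alg_hom_eqI[OF map_hom[OF X X idX] alg_id_hom[OF X.tensor_nonassoc_algebra]])
      fix a b assume "a \<in> carrier A" "b \<in> carrier X"
      then show "?t X X (alg_id X) (elem_tensor K A X a b) = alg_id (tensor K A X) (elem_tensor K A X a b)"
        using map_pure[OF X X idX] X.pure_closed by (simp add: alg_id_def)
    qed
    fix Y f assume Y: "Y \<in> Obj ?C" and "f \<in> Hom ?C X Y"
    then have f: "f \<in> alg_hom K X Y"
      by (simp add: C_hom)
    show "?t X Y f \<in> Hom ?D (tensor K A X) (tensor K A Y)"
      unfolding D_hom by (rule map_hom[OF X Y f])
    fix Z g assume Z: "Z \<in> Obj ?C" and "g \<in> Hom ?C Y Z"
    then have g: "g \<in> alg_hom K Y Z"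
      by (simp add: C_hom)
    have gf: "compose (carrier X) g f \<in> alg_hom K X Z"
      by (rule alg_hom_compose[OF B[OF X] f g])
    show "?t X Z (Comp ?C X Y Z g f)
        = Comp ?D (tensor K A X) (tensor K A Y) (tensor K A Z) (?t Y Z g) (?t X Y f)"
      unfolding C_hom D_hom
    proof (rule X.alg_hom_eqI[OF map_hom[OF X Z gf]
          alg_hom_compose[OF X.tensor_nonassoc_algebra map_hom[OF X Y f] map_hom[OF Y Z g]]])
      fix a b assume ab: "a \<in> carrier A" "b \<in> carrier X"
      then have "f b \<in> carrier Y"
        using f by (auto simp: alg_hom_def)
      with ab show "?t X Z (compose (carrier X) g f) (elem_tensor K A X a b)
          = compose (carrier (tensor K A X)) (?t Y Z g) (?t X Y f) (elem_tensor K A X a b)"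
        using map_pure[OF X Z gf] map_pure[OF X Y f] map_pure[OF Y Z g] X.pure_closed
        by (simp add: compose_eq)
    qed
  qed
  then show ?thesis
    using tensor_pair.pure_mult[OF pair] map_pure by (auto simp: C_hom)
qed

end
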